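(* Let $K$ be a field with $\operatorname{char} K \neq 2$, let $E$ be an elliptic curve defined over $K$, and let $P \in E(K)$ be a non-torsion point. Suppose that $P$ is magnified by doubling a point, i.e. there exist a finite extension $L/K$ with $[L:K] < 4$ and a point $R \in E(L)$ with $2R = P$. Then $P$ is $K$-magnified, i.e. there exist an elliptic curve $E'$ defined over $K$, an isogeny $\phi: E' \to E$ defined over $K$ with $\deg \phi > 1$, and a point $Q \in E'(K)$ with $\phi(Q) = P$.
   Context: Definition (paper's): for a field $K$, an elliptic curve $E/K$, a point $P\in E(K)$ and an isogeny $\phi:E'\to E$, $P$ is called magnified (by $\phi$) if $E'$, $\phi$ and some point of $\phi^{-1}(P)$ are all defined over a finite extension $L/K$ with $[L:K]<\deg\phi$; it is called $K$-magnified if this holds with $L=K$. "Magnified by doubling a point" means magnified with $\phi$ the multiplication-by-$2$ map $E\to E$ (of degree $4$). *)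

theory Defs
  imports
    "HOL-Algebra.Algebraic_Closure_Type"
    "HOL-Algebra.Generated_Fields"
    "HOL-Computational_Algebra.Computational_Algebra"
begin

section \<open>Degrees of field extensions\<close>

text \<open>
  Field extensions are pairs of subfields of a field given by a type. The value \<open>0\<close> stands for
  an infinite degree; a finite degree is never \<open>0\<close>.
\<close>

definition extension_degree :: "'a::field set \<Rightarrow> 'a set \<Rightarrow> nat" where
  "extension_degree F L =
     (if ring.finite_dimension ring_of_type_algebra F L
      then ring.dim ring_of_type_algebra F L else 0)"

definition finite_field_extension :: "'a::field set \<Rightarrow> 'a set \<Rightarrow> bool" where
  "finite_field_extension F L \<longleftrightarrow>
     subfield F ring_of_type_algebra \<and> subfield L ring_of_type_algebra \<and> F \<subseteq> L \<and>
     ring.finite_dimension ring_of_type_algebra F L"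


section \<open>Elliptic curves and their group law\<close>

text \<open>
  \<open>Weierstrass a1 a2 a3 a4 a6\<close> is the projective plane curve with affine equation
  \<open>y\<^sup>2 + a1 x y + a3 y = x\<^sup>3 + a2 x\<^sup>2 + a4 x + a6\<close>. The base change of a curve or a point along a
  field embedding \<open>\<iota>\<close> is \<open>map_curve \<iota>\<close> or \<open>map_point \<iota>\<close>.
\<close>

datatype 'a curve = Weierstrass 'a 'a 'a 'a 'a

datatype 'a point = Infinity | Affine 'a 'a

fun discriminant :: "'a::field curve \<Rightarrow> 'a" where
  "discriminant (Weierstrass a1 a2 a3 a4 a6) =
     (let b2 = a1\<^sup>2 + 4 * a2;
          b4 = 2 * a4 + a1 * a3;
          b6 = a3\<^sup>2 + 4 * a6;
          b8 = a1\<^sup>2 * a6 + 4 * a2 * a6 - a1 * a3 * a4 + a2 * a3\<^sup>2 - a4\<^sup>2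
      in - b2\<^sup>2 * b8 - 8 * b4 ^ 3 - 27 * b6\<^sup>2 + 9 * b2 * b4 * b6)"

definition elliptic_curve :: "'a::field curve \<Rightarrow> bool" where
  "elliptic_curve E \<longleftrightarrow> discriminant E \<noteq> 0"

fun on_curve :: "'a::field curve \<Rightarrow> 'a point \<Rightarrow> bool" where
  "on_curve E Infinity \<longleftrightarrow> True"
| "on_curve (Weierstrass a1 a2 a3 a4 a6) (Affine x y) \<longleftrightarrow>
     y\<^sup>2 + a1 * x * y + a3 * y = x ^ 3 + a2 * x\<^sup>2 + a4 * x + a6"

definition points_over :: "'a::field curve \<Rightarrow> 'a set \<Rightarrow> 'a point set" where
  "points_over E L = {P. on_curve E P \<and> set_point P \<subseteq> L}"

fun point_add :: "'a::field curve \<Rightarrow> 'a point \<Rightarrow> 'a point \<Rightarrow> 'a point" where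
  "point_add E Infinity Q = Q"
| "point_add E P Infinity = P"
| "point_add (Weierstrass a1 a2 a3 a4 a6) (Affine x1 y1) (Affine x2 y2) =
     (if x1 = x2 \<and> y1 + y2 + a1 * x2 + a3 = 0 then Infinity
      else let m = (if x1 = x2
                    then (3 * x1\<^sup>2 + 2 * a2 * x1 + a4 - a1 * y1) / (2 * y1 + a1 * x1 + a3)
                    else (y2 - y1) / (x2 - x1));
               x3 = m\<^sup>2 + a1 * m - a2 - x1 - x2
           in Affine x3 (- (y1 + m * (x3 - x1)) - a1 * x3 - a3))"

definition point_mult :: "'a::field curve \<Rightarrow> nat \<Rightarrow> 'a point \<Rightarrow> 'a point" where
  "point_mult E n P = (point_add E P ^^ n) Infinity"

definition torsion_point :: "'a::field curve \<Rightarrow> 'a point \<Rightarrow> bool" where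
  "torsion_point E P \<longleftrightarrow> (\<exists>n>0. point_mult E n P = Infinity)"


section \<open>Function fields\<close>

text \<open>
  The function field of a curve \<open>E\<close> over \<open>K\<close> is realised as the subfield \<open>K(x, y)\<close> of a fixed
  algebraic closure of the rational function field \<open>K(x)\<close>, where \<open>y\<close> is a root of the Weierstrass
  equation. This equation is irreducible over \<open>K(x)\<close>, and its other root lies in the same field,
  so the choice of \<open>y\<close> is immaterial.
\<close>

type_synonym 'k ambient = "'k poly fract alg_closure"

definition const_fn :: "'k::field \<Rightarrow> 'k ambient" where
  "const_fn c = to_ac (Fract [:c:] 1)"

definition x_fn :: "'k::field ambient" where
  "x_fn = to_ac (Fract [:0, 1:] 1)"

definition y_fn :: "'k::field curve \<Rightarrow> 'k ambient" where
  "y_fn E = (SOME y. on_curve (map_curve const_fn E) (Affine x_fn y))"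

lemma y_fn_on_curve: "on_curve (map_curve const_fn E) (Affine x_fn (y_fn E))"
proof -
  obtain a1 a2 a3 a4 a6 where E: "map_curve const_fn E = Weierstrass a1 a2 a3 a4 a6"
    using curve.exhaust by blast
  define c where "c = x_fn ^ 3 + a2 * x_fn\<^sup>2 + a4 * x_fn + a6"
  have "\<exists>y. poly [:- c, a1 * x_fn + a3, 1:] y = 0"
    by (rule alg_closed_imp_poly_has_root) auto
  then obtain y where "poly [:- c, a1 * x_fn + a3, 1:] y = 0" ..
  hence "on_curve (map_curve const_fn E) (Affine x_fn y)"
    by (simp add: E c_def algebra_simps power2_eq_square)
  thus ?thesis
    unfolding y_fn_def by (rule someI)
qed

definition function_field :: "'k::field curve \<Rightarrow> 'k ambient set" where
  "function_field E = generate_field ring_of_type_algebra (range const_fn \<union> {x_fn, y_fn E})"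


section \<open>Morphisms and isogenies\<close>

definition eval2 :: "('k::field \<Rightarrow> 'b::field) \<Rightarrow> 'k poly poly \<Rightarrow> 'b \<times> 'b \<Rightarrow> 'b" where
  "eval2 \<iota> p = (\<lambda>(u, v). poly (map_poly (\<lambda>q. poly (map_poly \<iota> q) u) p) v)"

text \<open>
  Affine coordinates around a geometric point \<open>Q\<close>, as functions and as their values at \<open>Q\<close>:
  \<open>(x, y)\<close> away from infinity, and \<open>(x/y, 1/y)\<close> at infinity.
\<close>

fun chart :: "'k::field curve \<Rightarrow> 'k alg_closure point \<Rightarrow> 'k ambient \<times> 'k ambient" where
  "chart E (Affine x y) = (x_fn, y_fn E)"
| "chart E Infinity = (x_fn / y_fn E, 1 / y_fn E)"

fun chart_value :: "'a::field point \<Rightarrow> 'a \<times> 'a" where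
  "chart_value (Affine x y) = (x, y)"
| "chart_value Infinity = (0, 0)"

text \<open>\<open>f\<close> lies in the local ring of \<open>E\<close> at \<open>Q\<close> and takes the value \<open>c\<close> there.\<close>

definition has_value_at ::
    "'k::field curve \<Rightarrow> 'k ambient \<Rightarrow> 'k alg_closure point \<Rightarrow> 'k alg_closure \<Rightarrow> bool" where
  "has_value_at E f Q c \<longleftrightarrow>
     (\<exists>g h. eval2 to_ac h (chart_value Q) \<noteq> 0 \<and>
            f = eval2 const_fn g (chart E Q) / eval2 const_fn h (chart E Q) \<and>
            c = eval2 to_ac g (chart_value Q) / eval2 to_ac h (chart_value Q))"

fun proj_coords :: "'a::field point \<Rightarrow> 'a \<times> 'a \<times> 'a" where
  "proj_coords (Affine x y) = (x, y, 1)"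
| "proj_coords Infinity = (0, 1, 0)"

text \<open>
  A rational map from \<open>E'\<close> to \<open>E\<close> over \<open>K\<close> is a point of \<open>E\<close> over the function field of \<open>E'\<close>. It is
  regular at \<open>Q\<close> with image \<open>P\<close> if its homogeneous coordinates can be multiplied by a function \<open>t\<close>
  so that they become regular at \<open>Q\<close>, with values there that are homogeneous coordinates of \<open>P\<close>.
\<close>

definition rational_map :: "'k::field curve \<Rightarrow> 'k curve \<Rightarrow> 'k ambient point \<Rightarrow> bool" where
  "rational_map E' E \<phi> \<longleftrightarrow> \<phi> \<in> points_over (map_curve const_fn E) (function_field E')"

definition maps_to ::
    "'k::field curve \<Rightarrow> 'k ambient point \<Rightarrow> 'k alg_closure point \<Rightarrow> 'k alg_closure point \<Rightarrow> bool"
  where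
  "maps_to E' \<phi> Q P \<longleftrightarrow>
     (\<exists>t\<in>function_field E'. \<exists>s. s \<noteq> 0 \<and>
        (case (proj_coords \<phi>, proj_coords P) of ((f, g, h), (u, v, w)) \<Rightarrow>
           has_value_at E' (t * f) Q (s * u) \<and>
           has_value_at E' (t * g) Q (s * v) \<and>
           has_value_at E' (t * h) Q (s * w)))"

definition morphism :: "'k::field curve \<Rightarrow> 'k curve \<Rightarrow> 'k ambient point \<Rightarrow> bool" where
  "morphism E' E \<phi> \<longleftrightarrow> rational_map E' E \<phi> \<and>
     (\<forall>Q. on_curve (map_curve to_ac E') Q \<longrightarrow>
        (\<exists>P. on_curve (map_curve to_ac E) P \<and> maps_to E' \<phi> Q P))"

definition isogeny :: "'k::field curve \<Rightarrow> 'k curve \<Rightarrow> 'k ambient point \<Rightarrow> bool" where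
  "isogeny E' E \<phi> \<longleftrightarrow> morphism E' E \<phi> \<and> \<phi> \<notin> range (map_point const_fn) \<and>
     maps_to E' \<phi> Infinity Infinity"

text \<open>For a nonconstant \<open>\<phi> = (X, Y)\<close>, the pullback of the function field of the target is \<open>K(X, Y)\<close>.\<close>

definition isogeny_degree :: "'k::field curve \<Rightarrow> 'k ambient point \<Rightarrow> nat" where
  "isogeny_degree E' \<phi> =
     extension_degree (generate_field ring_of_type_algebra (range const_fn \<union> set_point \<phi>))
       (function_field E')"


section \<open>Magnified points\<close>

text \<open>Finite extensions of \<open>K\<close> are taken inside an algebraic closure of \<open>K\<close>.\<close>

definition magnified_by_doubling :: "'k::field curve \<Rightarrow> 'k point \<Rightarrow> bool" where
  "magnified_by_doubling E P \<longleftrightarrow>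
     (\<exists>L. finite_field_extension (range to_ac) L \<and> extension_degree (range to_ac) L < 4 \<and>
        (\<exists>R\<in>points_over (map_curve to_ac E) L.
           point_add (map_curve to_ac E) R R = map_point to_ac P))"

definition K_magnified :: "'k::field curve \<Rightarrow> 'k point \<Rightarrow> bool" where
  "K_magnified E P \<longleftrightarrow>
     (\<exists>E' \<phi> Q. elliptic_curve E' \<and> isogeny E' E \<phi> \<and> isogeny_degree E' \<phi> > 1 \<and>
        on_curve E' Q \<and> maps_to E' \<phi> (map_point to_ac Q) (map_point to_ac P))"

end

theory Submission
  imports Defs
begin

text \<open>
  Choose coordinates with \<open>P = (0, v)\<close> and \<open>E: y\<^sup>2 = x\<^sup>3 + a x\<^sup>2 + b x + v\<^sup>2\<close>. A half \<open>R\<close> of \<open>P\<close>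
  is determined by the slope \<open>m\<close> of the tangent at \<open>R\<close>. These slopes are the roots of the quartic
  \<open>m\<^sup>4 - 2 a m\<^sup>2 - 8 v m + a\<^sup>2 - 4 b\<close>. If a root has degree less than 4 over \<open>K\<close>, the quartic is
  reducible. Either it has a root in \<open>K\<close>, and \<open>P\<close> is twice a point of \<open>E(K)\<close>, or it is a product
  \<open>(m\<^sup>2 + p m + s) (m\<^sup>2 - p m + t)\<close>. Then \<open>p \<noteq> 0\<close> because \<open>v \<noteq> 0\<close>, and \<open>-(p/2)\<^sup>2\<close> is the
  abscissa of a 2-torsion point \<open>T\<close> over \<open>K\<close> for which \<open>x(P) - x(T)\<close> is a square. Hence \<open>P\<close> is in
  the image of \<open>E'(K)\<close> under the isogeny of degree 2 dual to \<open>E \<rightarrow> E / \<langle>T\<rangle>\<close>.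
\<close>

hide_const (open) Polynomials.degree

section \<open>Evaluation of polynomials along a ring homomorphism\<close>

definition eval_poly :: "('a::comm_ring_1 \<Rightarrow> 'b::comm_ring_1) \<Rightarrow> 'a poly \<Rightarrow> 'b \<Rightarrow> 'b" where
  "eval_poly h p u = poly (map_poly h p) u"

locale comm_ring_hom =
  fixes h :: "'a::comm_ring_1 \<Rightarrow> 'b::comm_ring_1"
  assumes hom_add [simp]: "h (x + y) = h x + h y"
    and hom_mult [simp]: "h (x * y) = h x * h y"
    and hom_1 [simp]: "h 1 = 1"
begin

lemma hom_0 [simp]: "h 0 = 0"
  using hom_add[of 0 0] by simp

lemma hom_minus [simp]: "h (- x) = - h x"
  using hom_add[of x "- x"] by (simp add: eq_neg_iff_add_eq_0 add.commute)

lemma hom_diff [simp]: "h (x - y) = h x - h y"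
  using hom_add[of x "- y"] by simp

lemma hom_power [simp]: "h (x ^ n) = h x ^ n"
  by (induction n) auto

lemma hom_of_nat [simp]: "h (of_nat n) = of_nat n"
  by (induction n) auto

lemma hom_numeral [simp]: "h (numeral n) = numeral n"
  using hom_of_nat[of "numeral n"] by simp

lemma hom_sum [simp]: "h (sum f A) = (\<Sum>x\<in>A. h (f x))"
  by (induction A rule: infinite_finite_induct) auto

lemma eval_poly_0 [simp]: "eval_poly h 0 u = 0"
  by (simp add: eval_poly_def)

lemma eval_poly_pCons [simp]: "eval_poly h (pCons x p) u = h x + u * eval_poly h p u"
  by (simp add: eval_poly_def map_poly_pCons)

lemma eval_poly_add: "eval_poly h (p + q) u = eval_poly h p u + eval_poly h q u"
  by (induction p q rule: poly_induct2) (auto simp: algebra_simps)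

lemma eval_poly_smult [simp]: "eval_poly h (smult x p) u = h x * eval_poly h p u"
  by (induction p) (auto simp: algebra_simps)

lemma eval_poly_mult: "eval_poly h (p * q) u = eval_poly h p u * eval_poly h q u"
  by (induction p) (auto simp: algebra_simps eval_poly_add)

lemma comm_ring_hom_eval_poly: "comm_ring_hom (\<lambda>p. eval_poly h p u)"
  by unfold_locales (auto simp: eval_poly_add eval_poly_mult one_pCons)

lemma eval_poly_altdef: "eval_poly h p u = (\<Sum>i\<le>degree p. h (coeff p i) * u ^ i)"
proof -
  have monom: "eval_poly h (Polynomial.monom k n) u = h k * u ^ n" for k n
    by (induction n) (auto simp: monom_0 monom_Suc)
  have "eval_poly h p u = eval_poly h (\<Sum>i\<le>degree p. Polynomial.monom (coeff p i) i) u"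
    by (simp only: poly_as_sum_of_monoms)
  thus ?thesis
    by (simp add: comm_ring_hom.hom_sum[OF comm_ring_hom_eval_poly] monom)
qed

lemma eval_poly_closed:
  assumes "\<And>x y. x \<in> S \<Longrightarrow> y \<in> S \<Longrightarrow> x + y \<in> S" "\<And>x y. x \<in> S \<Longrightarrow> y \<in> S \<Longrightarrow> x * y \<in> S"
    and "range h \<subseteq> S" "u \<in> S"
  shows "eval_poly h p u \<in> S"
proof (induction p)
  case 0
  have "h 0 \<in> S" using assms(3) by blast
  thus ?case by simp
next
  case (pCons k p)
  have "h k \<in> S" using assms(3) by blast
  thus ?case using assms pCons.IH by simp
qed

end

lemma comm_ring_hom_id: "comm_ring_hom (\<lambda>x. x)"
  by unfold_locales auto

lemma eval_poly_id: "eval_poly (\<lambda>x. x) p u = poly p u"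
  by (simp add: eval_poly_def)

lemma eval2_eq_eval_poly: "eval2 \<iota> g (u, v) = eval_poly (\<lambda>p. eval_poly \<iota> p u) g v"
  by (simp add: eval2_def eval_poly_def)

interpretation to_ac: comm_ring_hom to_ac
  by unfold_locales auto

interpretation const_fn: comm_ring_hom const_fn
  by unfold_locales
    (auto simp: const_fn_def one_pCons fract_expand mult.commute simp flip: to_ac_add to_ac_mult)

interpretation to_ac_eval: comm_ring_hom "\<lambda>p. eval_poly to_ac p u" for u
  by (rule to_ac.comm_ring_hom_eval_poly)

interpretation const_fn_eval: comm_ring_hom "\<lambda>p. eval_poly const_fn p u" for u
  by (rule const_fn.comm_ring_hom_eval_poly)

lemma const_fn_eq_0_iff [simp]: "const_fn k = 0 \<longleftrightarrow> k = 0"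
  unfolding const_fn_def to_ac_eq_0_iff Zero_fract_def by (simp add: eq_fract)

lemma eval_poly_to_ac: "eval_poly to_ac p (to_ac u) = to_ac (poly p u)"
  by (induction p) auto

section \<open>Subfields of a field given by a type\<close>

lemma type_algebra_simps [simp]:
  "carrier ring_of_type_algebra = UNIV"
  "x \<otimes>\<^bsub>ring_of_type_algebra\<^esub> y = x * y"
  "x \<oplus>\<^bsub>ring_of_type_algebra\<^esub> y = x + y"
  "\<one>\<^bsub>ring_of_type_algebra\<^esub> = 1"
  "\<zero>\<^bsub>ring_of_type_algebra\<^esub> = 0"
  by (simp_all add: ring_of_type_algebra_def)

context
begin

interpretation type_field: field "ring_of_type_algebra :: 'a::field ring"
  by rule

lemma a_inv_type_algebra [simp]: "\<ominus>\<^bsub>ring_of_type_algebra\<^esub> x = - (x :: 'a::field)"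
  using type_field.minus_equality[of "- x" x] by simp

lemma m_inv_type_algebra [simp]:
  "x \<noteq> 0 \<Longrightarrow> inv\<^bsub>ring_of_type_algebra\<^esub> x = inverse (x :: 'a::field)"
  using type_field.comm_inv_char[of x "inverse x"] by simp

lemma pow_type_algebra [simp]: "x [^]\<^bsub>ring_of_type_algebra\<^esub> (n::nat) = (x :: 'a::field) ^ n"
  by (induction n) auto

lemma eval_type_algebra:
  "ring.eval ring_of_type_algebra xs x = poly (Poly (rev xs)) (x :: 'a::field)"
  by (induction xs) (auto simp: Poly_snoc poly_monom)

lemma subfield_type_algebraI:
  fixes S :: "'a::field set"
  assumes "1 \<in> S" "\<And>x y. x \<in> S \<Longrightarrow> y \<in> S \<Longrightarrow> x + y \<in> S" "\<And>x y. x \<in> S \<Longrightarrow> y \<in> S \<Longrightarrow> x * y \<in> S"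
    and "\<And>x. x \<in> S \<Longrightarrow> - x \<in> S" "\<And>x. x \<in> S \<Longrightarrow> inverse x \<in> S"
  shows "subfield S ring_of_type_algebra"
  by (rule type_field.subfieldI', rule type_field.subringI) (use assms in auto)

lemma subfield_type_algebraD:
  fixes S :: "'a::field set"
  assumes "subfield S ring_of_type_algebra"
  shows "0 \<in> S" "1 \<in> S"
    and "\<And>x y. x \<in> S \<Longrightarrow> y \<in> S \<Longrightarrow> x + y \<in> S" "\<And>x y. x \<in> S \<Longrightarrow> y \<in> S \<Longrightarrow> x * y \<in> S"
    and "\<And>x. x \<in> S \<Longrightarrow> - x \<in> S" "\<And>x. x \<in> S \<Longrightarrow> inverse x \<in> S"
    and "\<And>x y. x \<in> S \<Longrightarrow> y \<in> S \<Longrightarrow> x - y \<in> S" "\<And>x y. x \<in> S \<Longrightarrow> y \<in> S \<Longrightarrow> x / y \<in> S"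
    and "\<And>x n. x \<in> S \<Longrightarrow> x ^ n \<in> S"
proof -
  note subring = subfieldE(1)[OF assms]
  show zero: "0 \<in> S" and one: "1 \<in> S"
    using subringE(2,3)[OF subring] by auto
  show add: "x + y \<in> S" and mult: "x * y \<in> S" if "x \<in> S" "y \<in> S" for x y
    using subringE(6,7)[OF subring] that by auto
  show minus: "- x \<in> S" if "x \<in> S" for x
    using subringE(5)[OF subring] that by auto
  show inverse: "inverse x \<in> S" if "x \<in> S" for x
    using type_field.subfield_m_inv(1)[OF assms, of x] that by (cases "x = 0") auto
  show "x - y \<in> S" if "x \<in> S" "y \<in> S" for x y
    using add[OF that(1) minus[OF that(2)]] by simp
  show "x / y \<in> S" if "x \<in> S" "y \<in> S" for x y
    using mult[OF that(1) inverse[OF that(2)]] by (simp add: divide_inverse)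
  show "x ^ n \<in> S" if "x \<in> S" for x n
    by (induction n) (auto intro: one mult that)
qed

lemma subfield_generate_field:
  "subfield (generate_field ring_of_type_algebra H) (ring_of_type_algebra :: 'a::field ring)"
  by (rule type_field.generate_field_is_subfield) simp

lemma generate_field_subset:
  fixes S :: "'a::field set"
  assumes "subfield S ring_of_type_algebra" "H \<subseteq> S"
  shows "generate_field ring_of_type_algebra H \<subseteq> S"
  by (rule type_field.generate_field_min_subfield1) (use assms in auto)

lemma algebraic_type_algebraI:
  fixes F :: "'a::field set"
  assumes "p \<noteq> 0" "set (coeffs p) \<subseteq> F" "poly p x = 0"
  shows "(ring.algebraic ring_of_type_algebra over F) x"
proof (rule type_field.algebraicI)
  have "hd (rev (coeffs p)) \<noteq> 0"
    using assms(1) by (simp add: hd_rev last_coeffs_eq_coeff_degree)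
  thus "rev (coeffs p) \<in> carrier (F [X]\<^bsub>ring_of_type_algebra\<^esub>)"
    using assms by (auto simp: univ_poly_def polynomial_def)
qed (use assms in \<open>auto simp: eval_type_algebra\<close>)

lemma subfield_simple_extension:
  fixes F :: "'a::field set"
  assumes "subfield F ring_of_type_algebra" "p \<noteq> 0" "set (coeffs p) \<subseteq> F" "poly p x = 0"
  shows "subfield (ring.simple_extension ring_of_type_algebra F x) ring_of_type_algebra"
  using type_field.simple_extension_is_subfield[OF assms(1), of x]
    algebraic_type_algebraI[OF assms(2-4)] by simp

lemma finite_dimension_if_simple:
  fixes F L :: "'a::field set"
  assumes F: "subfield F ring_of_type_algebra" and L: "subfield L ring_of_type_algebra" "F \<subseteq> L"
    and p: "p \<noteq> 0" "set (coeffs p) \<subseteq> F" "poly p x = 0"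
    and least: "\<And>S. subfield S ring_of_type_algebra \<Longrightarrow> F \<subseteq> S \<Longrightarrow> x \<in> S \<Longrightarrow> L \<subseteq> S"
  shows "ring.finite_dimension ring_of_type_algebra F L"
proof -
  let ?S = "ring.simple_extension ring_of_type_algebra F x"
  have "F \<subseteq> ?S"
    by (rule type_field.simple_extension_incl) auto
  moreover have "x \<in> ?S"
    by (rule type_field.simple_extension_mem[OF subfieldE(1)[OF F]]) auto
  ultimately have "L \<subseteq> ?S"
    by (rule least[OF subfield_simple_extension[OF F p]])
  moreover have "type_field.finite_dimension F ?S"
    using type_field.finite_dimension_simple_extension[OF F] algebraic_type_algebraI[OF p] by auto
  moreover have "subalgebra F L ring_of_type_algebra"
    using subfield_type_algebraD(4)[OF L(1)] L(2) subring.axioms(1)[OF subfieldE(1)[OF L(1)]]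
    by (auto simp: subalgebra_def subalgebra_axioms_def)
  ultimately show ?thesis
    using type_field.subalbegra_incl_imp_finite_dimension[OF F] by blast
qed

lemma extension_degree_gt_1:
  fixes F L :: "'a::field set"
  assumes F: "subfield F ring_of_type_algebra" and L: "subfield L ring_of_type_algebra"
    and "F \<subset> L" and finite: "ring.finite_dimension ring_of_type_algebra F L"
  shows "extension_degree F L > 1"
proof -
  define n where "n = type_field.dim F L"
  have dimension_n: "type_field.dimension n F L"
    using type_field.finite_dimensionE[OF F finite] by (simp add: n_def over_def)
  have "n \<noteq> 0"
    using type_field.dimension_zero[OF F, of L] dimension_n subfield_type_algebraD(2)[OF L]
    by (cases n) auto
  moreover have "n \<noteq> 1"
  proof
    assume "n = 1"
    obtain Vs where Vs: "type_field.independent F Vs" "length Vs = 1" "type_field.Span F Vs = F"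
      using type_field.exists_base[OF F type_field.dimension_one[OF F]] by auto
    hence "set Vs \<subseteq> L"
      using type_field.Span_base_incl[OF F, of Vs] \<open>F \<subset> L\<close> by auto
    hence "type_field.Span F Vs = L"
      using type_field.independent_length_eq_dimension[OF F dimension_n Vs(1)] Vs(2) \<open>n = 1\<close> by auto
    thus False using Vs(3) \<open>F \<subset> L\<close> by auto
  qed
  ultimately show ?thesis
    using finite by (simp add: extension_degree_def flip: n_def)
qed

lemma exists_vanishing_combination_of_powers:
  fixes F L :: "'a::field set"
  assumes extension: "finite_field_extension F L" and "m \<in> L"
  obtains ks where "length ks = Suc (extension_degree F L)" "set ks \<subseteq> F" "set ks \<noteq> {0}"
    and "poly (Poly (rev ks)) m = 0"
proof -
  have F: "subfield F ring_of_type_algebra" and L: "subfield L ring_of_type_algebra"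
    and finite: "type_field.finite_dimension F L"
    using extension by (auto simp: finite_field_extension_def)
  define n where "n = extension_degree F L"
  have dimension_n: "type_field.dimension n F L"
    using type_field.finite_dimensionE[OF F finite] finite
    by (simp add: n_def over_def extension_degree_def)
  let ?powers = "type_field.exp_base m (Suc n)"
  have "set ?powers \<subseteq> L"
    using subfield_type_algebraD(9)[OF L \<open>m \<in> L\<close>] by (auto simp: type_field.exp_base_def)
  hence "\<not> type_field.independent F ?powers"
    using type_field.independent_length_le_dimension[OF F dimension_n, of ?powers]
    by (auto simp: type_field.exp_base_def)
  then obtain ks where ks: "length ks = Suc n" "type_field.combine ks ?powers = 0"
      "set ks \<subseteq> F" "set ks \<noteq> {0}"
    using type_field.dependent_imp_non_trivial_combine[OF F, of ?powers]
    by (auto simp: type_field.exp_base_def)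
  moreover from this have "poly (Poly (rev ks)) m = 0"
    using type_field.combine_eq_eval[of ks m] by (simp add: eval_type_algebra)
  ultimately show thesis
    using that by (simp add: n_def)
qed

end

lemma exists_annihilating_poly:
  fixes L :: "'k::field alg_closure set"
  assumes "finite_field_extension (range to_ac) L" "m \<in> L"
  obtains p where "p \<noteq> 0" "degree p \<le> extension_degree (range to_ac) L" "eval_poly to_ac p m = 0"
proof -
  obtain ks where length: "length ks = Suc (extension_degree (range to_ac) L)"
    and ks: "set ks \<subseteq> range (to_ac :: 'k \<Rightarrow> _)" "set ks \<noteq> {0}" "poly (Poly (rev ks)) m = 0"
    using exists_vanishing_combination_of_powers[OF assms] .
  from ks(1) obtain cs :: "'k list" where cs: "ks = map to_ac cs"
    by (metis ex_map_conv subset_iff rangeE)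
  show thesis
  proof
    show "degree (Poly (rev cs)) \<le> extension_degree (range to_ac) L"
      using length by (intro degree_le) (auto simp: cs nth_default_def)
    show "Poly (rev cs) \<noteq> 0"
    proof
      assume "Poly (rev cs) = 0"
      then obtain i where "cs = replicate i 0"
        by (metis Poly_eq_0 rev_replicate rev_rev_ident)
      thus False using length ks(2) by (cases i) (auto simp: cs)
    qed
    have "map_poly to_ac (Poly xs) = Poly (map to_ac xs)" for xs :: "'k list"
      by (induction xs) (auto simp: map_poly_pCons)
    thus "eval_poly to_ac (Poly (rev cs)) m = 0"
      using ks(3) by (simp add: eval_poly_def cs rev_map)
  qed
qed

lemma reducible_if_root_in_small_extension:
  fixes g :: "'k::field poly"
  assumes L: "finite_field_extension (range to_ac) L" "m \<in> L"
    and g: "eval_poly to_ac g m = 0" "extension_degree (range to_ac) L < degree g"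
  obtains q r where "g = q * r" "degree q > 0" "degree r > 0"
proof -
  obtain p where p: "p \<noteq> 0" "degree p \<le> extension_degree (range to_ac) L" "eval_poly to_ac p m = 0"
    using exists_annihilating_poly[OF L] .
  obtain q where q: "q \<noteq> 0" "eval_poly to_ac q m = 0" "degree q \<le> degree p"
    and minimal: "\<And>r. r \<noteq> 0 \<Longrightarrow> eval_poly to_ac r m = 0 \<Longrightarrow> degree q \<le> degree r"
    using ex_has_least_nat[of "\<lambda>q. q \<noteq> 0 \<and> eval_poly to_ac q m = 0" p degree] p(1,3) by blast
  have "eval_poly to_ac (g mod q) m = 0"
    using g(1) q(2) by (simp flip: minus_div_mult_eq_mod)
  hence "g mod q = 0"
    using minimal[of "g mod q"] degree_mod_less[OF q(1), of g] by fastforce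
  then obtain r where r: "g = q * r" by auto
  have "degree q > 0"
  proof (rule ccontr)
    assume "\<not> degree q > 0"
    then obtain k where "q = [:k:]" by (metis degree_eq_zeroE neq0_conv)
    thus False using q by simp
  qed
  moreover have "degree r > 0"
    using g(2) p(2) q(3) degree_mult_le[of q r] unfolding r by linarith
  ultimately show thesis using r that by blast
qed

section \<open>The function field of a Weierstrass curve\<close>

lemma on_curve_map_curve_iff:
  assumes "comm_ring_hom h"
  shows "on_curve (map_curve h (Weierstrass a1 a2 a3 a4 a6)) (Affine u v) \<longleftrightarrow>
    v\<^sup>2 = eval_poly h [:a6, a4, a2, 1:] u - eval_poly h [:a3, a1:] u * v"
proof -
  interpret comm_ring_hom h by fact
  show ?thesis
    by (auto simp: algebra_simps power2_eq_square power3_eq_cube)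
qed

abbreviation poly_fn :: "'k::field poly \<Rightarrow> 'k ambient" where
  "poly_fn p \<equiv> eval_poly const_fn p x_fn"

lemma poly_fn_eq_to_ac: "poly_fn p = to_ac (Fract p 1)"
proof (induction p)
  case 0
  show ?case by (simp add: fract_collapse)
next
  case (pCons k p)
  have "to_ac (Fract (pCons k p) 1) = to_ac (Fract [:k:] 1 + Fract [:0, 1:] 1 * Fract p 1)"
    by simp
  thus ?case
    by (simp only: to_ac_add to_ac_mult const_fn.eval_poly_pCons pCons.IH
        flip: const_fn_def x_fn_def)
qed

lemma poly_fn_inject: "poly_fn p = poly_fn q \<longleftrightarrow> p = q"
  by (simp add: poly_fn_eq_to_ac eq_fract)

lemma poly_fn_eq_0_iff [simp]: "poly_fn p = 0 \<longleftrightarrow> p = 0"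
  using poly_fn_inject[of p 0] by simp

lemma x_fn_neq_0 [simp]: "x_fn \<noteq> 0"
  using poly_fn_eq_0_iff[of "[:0, 1:]"] by simp

lemma y_fn_squared:
  "(y_fn (Weierstrass a1 a2 a3 a4 a6))\<^sup>2 =
    poly_fn [:a6, a4, a2, 1:] - poly_fn [:a3, a1:] * y_fn (Weierstrass a1 a2 a3 a4 a6)"
  using y_fn_on_curve on_curve_map_curve_iff[OF const_fn.comm_ring_hom_axioms] by blast

lemma Weierstrass_relation_imp_eq_0:
  fixes p q l f :: "'k::field poly"
  assumes "degree l \<le> 1" "degree f = 3" and relation: "p\<^sup>2 - l * p * q = f * q\<^sup>2"
  shows "q = 0"
proof (rule ccontr)
  assume "q \<noteq> 0"
  have "f \<noteq> 0" using \<open>degree f = 3\<close> by auto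
  hence degree_rhs: "degree (p * (p - l * q)) = 3 + 2 * degree q"
    using \<open>q \<noteq> 0\<close> \<open>degree f = 3\<close> relation
    by (simp add: degree_mult_eq degree_power_eq power2_eq_square algebra_simps)
  have degree_lq: "degree (l * q) \<le> 1 + degree q"
    using degree_mult_le[of l q] \<open>degree l \<le> 1\<close> by linarith
  show False
  proof (cases "degree p \<le> 1 + degree q")
    case True
    hence "degree (p - l * q) \<le> 1 + degree q"
      using degree_lq by (intro degree_diff_le)
    thus False
      using True degree_mult_le[of p "p - l * q"] degree_rhs by linarith
  next
    case False
    hence "degree (p - l * q) = degree p"
      using degree_lq degree_add_eq_left[of "- (l * q)" p] by simp
    moreover have "p \<noteq> 0" "p - l * q \<noteq> 0"
      using degree_rhs by auto
    ultimately have "2 * degree p = 3 + 2 * degree q"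
      using degree_rhs by (simp add: degree_mult_eq)
    thus False by presburger
  qed
qed

lemma y_fn_independent:
  assumes "poly_fn p + poly_fn q * y_fn E = 0"
  shows "p = 0" "q = 0"
proof -
  obtain a1 a2 a3 a4 a6 where E: "E = Weierstrass a1 a2 a3 a4 a6" by (cases E)
  let ?l = "[:a3, a1:]" and ?f = "[:a6, a4, a2, 1:]"
  have p: "poly_fn p = - (poly_fn q * y_fn E)"
    using assms by (simp add: eq_neg_iff_add_eq_0)
  have "poly_fn (p\<^sup>2 - ?l * p * q) = (poly_fn q)\<^sup>2 * ((y_fn E)\<^sup>2 + poly_fn ?l * y_fn E)"
    by (simp add: p algebra_simps power2_eq_square)
  also have "\<dots> = poly_fn (?f * q\<^sup>2)"
    unfolding E y_fn_squared by (simp add: algebra_simps power2_eq_square)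
  finally have "p\<^sup>2 - ?l * p * q = ?f * q\<^sup>2"
    by (simp only: poly_fn_inject)
  thus "q = 0"
    by (rule Weierstrass_relation_imp_eq_0[rotated 2]) simp_all
  thus "p = 0"
    using p by simp
qed

lemma y_fn_neq_0 [simp]: "y_fn E \<noteq> 0"
  using y_fn_independent(2)[of 0 1 E] by auto

lemma subfield_function_field: "subfield (function_field E) ring_of_type_algebra"
  unfolding function_field_def by (rule subfield_generate_field)

lemma function_field_generators:
  "const_fn k \<in> function_field E" "x_fn \<in> function_field E" "y_fn E \<in> function_field E"
  by (auto simp: function_field_def intro: generate_field.incl)

lemma poly_fn_in_function_field: "poly_fn p \<in> function_field E"
  using subfield_type_algebraD[OF subfield_function_field] function_field_generators
  by (intro const_fn.eval_poly_closed) auto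

lemmas function_field_intros =
  subfield_type_algebraD[OF subfield_function_field] function_field_generators
  poly_fn_in_function_field

section \<open>Values of functions at points\<close>

lemma mult_reduce_quadratic:
  fixes w :: "'a::comm_ring_1"
  assumes "w\<^sup>2 = f - l * w"
  shows "k + w * (s + t * w) = k + t * f + (s - t * l) * w"
proof -
  have "t * w\<^sup>2 = t * (f - l * w)" by (simp only: assms)
  thus ?thesis by (simp add: algebra_simps power2_eq_square)
qed

lemma affine_normal_form:
  assumes "on_curve (map_curve to_ac E) (Affine u v)"
  obtains p q where "eval2 const_fn g (x_fn, y_fn E) = poly_fn p + poly_fn q * y_fn E"
    and "eval2 to_ac g (u, v) = eval_poly to_ac p u + eval_poly to_ac q u * v"
proof -
  obtain a1 a2 a3 a4 a6 where E: "E = Weierstrass a1 a2 a3 a4 a6" by (cases E)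
  let ?l = "[:a3, a1:]" and ?f = "[:a6, a4, a2, 1:]"
  have v: "v\<^sup>2 = eval_poly to_ac ?f u - eval_poly to_ac ?l u * v"
    using assms unfolding E on_curve_map_curve_iff[OF to_ac.comm_ring_hom_axioms] .
  note y = y_fn_squared[of a1 a2 a3 a4 a6, folded E]
  have "\<exists>p q. eval2 const_fn g (x_fn, y_fn E) = poly_fn p + poly_fn q * y_fn E \<and>
    eval2 to_ac g (u, v) = eval_poly to_ac p u + eval_poly to_ac q u * v"
  proof (induction g)
    case 0
    show ?case by (intro exI[of _ 0]) (simp add: eval2_eq_eval_poly)
  next
    case (pCons c g)
    then obtain p q where IH: "eval2 const_fn g (x_fn, y_fn E) = poly_fn p + poly_fn q * y_fn E"
      "eval2 to_ac g (u, v) = eval_poly to_ac p u + eval_poly to_ac q u * v"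
      by blast
    have "eval2 const_fn (pCons c g) (x_fn, y_fn E) =
        poly_fn (c + q * ?f) + poly_fn (p - q * ?l) * y_fn E"
      using mult_reduce_quadratic[OF y] IH(1)
      by (simp only: eval2_eq_eval_poly const_fn_eval.eval_poly_pCons const_fn_eval.hom_add
          const_fn_eval.hom_mult const_fn_eval.hom_diff)
    moreover have "eval2 to_ac (pCons c g) (u, v) =
        eval_poly to_ac (c + q * ?f) u + eval_poly to_ac (p - q * ?l) u * v"
      using mult_reduce_quadratic[OF v] IH(2)
      by (simp only: eval2_eq_eval_poly to_ac_eval.eval_poly_pCons to_ac_eval.hom_add
          to_ac_eval.hom_mult to_ac_eval.hom_diff)
    ultimately show ?case by blast
  qed
  thus thesis using that by blast
qed

lemma affine_chart_eq_0_imp: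
  assumes "on_curve (map_curve to_ac E) (Affine u v)" "eval2 const_fn g (x_fn, y_fn E) = 0"
  shows "eval2 to_ac g (u, v) = 0"
proof -
  obtain p q where "poly_fn p + poly_fn q * y_fn E = 0"
      and "eval2 to_ac g (u, v) = eval_poly to_ac p u + eval_poly to_ac q u * v"
    using affine_normal_form[OF assms(1)] assms(2) by metis
  thus ?thesis using y_fn_independent by fastforce
qed

text \<open>
  Put \<open>t = 1/x\<close> and \<open>z = x/y\<close>. Over the local ring of \<open>K[t]\<close> at \<open>t = 0\<close>, \<open>z\<close> satisfies a monic
  quadratic equation, and \<open>1/y = t z\<close>. Every polynomial in \<open>z\<close> and \<open>1/y\<close> is therefore of the form
  \<open>p(t) + q(t) z\<close>, up to a unit of this local ring, and \<open>p(0)\<close> is its value at infinity.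
\<close>

abbreviation recip_poly_fn :: "'k::field poly \<Rightarrow> 'k ambient" where
  "recip_poly_fn p \<equiv> eval_poly const_fn p (inverse x_fn)"

definition expands_at_infinity :: "'k::field curve \<Rightarrow> 'k ambient \<Rightarrow> 'k \<Rightarrow> bool" where
  "expands_at_infinity E g k \<longleftrightarrow>
     (\<exists>d p q. poly d 0 = 1 \<and> poly p 0 = k \<and>
        recip_poly_fn d * g = recip_poly_fn p + recip_poly_fn q * (x_fn / y_fn E))"

lemma expands_at_infinityI:
  assumes "poly d 0 = 1" "poly p 0 = k"
    and "recip_poly_fn d * g = recip_poly_fn p + recip_poly_fn q * (x_fn / y_fn E)"
  shows "expands_at_infinity E g k"
  using assms unfolding expands_at_infinity_def by blast

lemma expands_at_infinity_const: "expands_at_infinity E (const_fn k) k"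
  by (rule expands_at_infinityI[of 1 "[:k:]" _ _ 0]) auto

lemma expands_at_infinity_add:
  assumes "expands_at_infinity E g k" "expands_at_infinity E g' k'"
  shows "expands_at_infinity E (g + g') (k + k')"
proof -
  obtain d p q d' p' q' where "poly d 0 = 1" "poly p 0 = k" "poly d' 0 = 1" "poly p' 0 = k'"
    and eqs: "recip_poly_fn d * g = recip_poly_fn p + recip_poly_fn q * (x_fn / y_fn E)"
      "recip_poly_fn d' * g' = recip_poly_fn p' + recip_poly_fn q' * (x_fn / y_fn E)"
    using assms unfolding expands_at_infinity_def by blast
  moreover have "recip_poly_fn (d * d') * (g + g') =
      recip_poly_fn d' * (recip_poly_fn d * g) + recip_poly_fn d * (recip_poly_fn d' * g')"
    by (simp add: algebra_simps)
  hence "recip_poly_fn (d * d') * (g + g') = recip_poly_fn (d' * p + d * p') +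
      recip_poly_fn (d' * q + d * q') * (x_fn / y_fn E)"
    by (simp only: eqs) (simp add: algebra_simps)
  ultimately show ?thesis
    by (intro expands_at_infinityI[of "d * d'" "d' * p + d * p'" _ _ "d' * q + d * q'"]) auto
qed

lemma Weierstrass_equation_at_infinity:
  fixes x y :: "'a::field"
  assumes "x \<noteq> 0" "y \<noteq> 0" and "y\<^sup>2 = a6 + x * (a4 + x * (a2 + x)) - (a3 + x * a1) * y"
  shows "(1 + inverse x * (a2 + inverse x * (a4 + inverse x * a6))) * (x / y)\<^sup>2 =
    inverse x + inverse x * (a1 + inverse x * a3) * (x / y)"
proof -
  have "(1 + inverse x * (a2 + inverse x * (a4 + inverse x * a6))) * (x / y)\<^sup>2 =
      (a6 + x * (a4 + x * (a2 + x))) / (x * y\<^sup>2)"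
    using assms(1,2) by (simp add: field_simps power2_eq_square)
  also have "a6 + x * (a4 + x * (a2 + x)) = y\<^sup>2 + (a3 + x * a1) * y"
    using assms(3) by simp
  also have "(y\<^sup>2 + (a3 + x * a1) * y) / (x * y\<^sup>2) =
      inverse x + inverse x * (a1 + inverse x * a3) * (x / y)"
    using assms(1,2) by (simp add: field_simps power2_eq_square)
  finally show ?thesis .
qed

lemma x_over_y_squared:
  fixes a1 a2 a3 a4 a6 :: "'k::field"
  defines "E \<equiv> Weierstrass a1 a2 a3 a4 a6"
  shows "recip_poly_fn [:1, a2, a4, a6:] * (x_fn / y_fn E)\<^sup>2 =
    recip_poly_fn [:0, 1:] + recip_poly_fn [:0, a1, a3:] * (x_fn / y_fn E)"
  using Weierstrass_equation_at_infinity[OF x_fn_neq_0 y_fn_neq_0[of E],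
      of "const_fn a6" "const_fn a4" "const_fn a2" "const_fn a3" "const_fn a1"]
    y_fn_squared[of a1 a2 a3 a4 a6]
  by (simp add: E_def)

lemma expands_at_infinity_mult_z:
  assumes "expands_at_infinity E g k"
  shows "expands_at_infinity E (x_fn / y_fn E * g) 0"
proof -
  obtain d p q where d: "poly d 0 = 1" "poly p 0 = k"
    and eq: "recip_poly_fn d * g = recip_poly_fn p + recip_poly_fn q * (x_fn / y_fn E)"
    using assms unfolding expands_at_infinity_def by blast
  obtain a1 a2 a3 a4 a6 where E: "E = Weierstrass a1 a2 a3 a4 a6" by (cases E)
  define z where "z = x_fn / y_fn E"
  have z: "recip_poly_fn [:1, a2, a4, a6:] * z\<^sup>2 =
      recip_poly_fn [:0, 1:] + recip_poly_fn [:0, a1, a3:] * z"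
    unfolding z_def E by (rule x_over_y_squared)
  note eq = eq[folded z_def]
  show ?thesis
  proof (rule expands_at_infinityI)
    show "poly (d * [:1, a2, a4, a6:]) 0 = 1" "poly ([:0, 1:] * q) 0 = 0"
      using d by simp_all
    have "recip_poly_fn (d * [:1, a2, a4, a6:]) * (z * g) =
        recip_poly_fn [:1, a2, a4, a6:] * z * (recip_poly_fn d * g)"
      by (simp only: const_fn_eval.hom_mult ac_simps)
    also have "\<dots> = recip_poly_fn [:1, a2, a4, a6:] * z * recip_poly_fn p
        + recip_poly_fn q * (recip_poly_fn [:1, a2, a4, a6:] * z\<^sup>2)"
      unfolding eq by (simp only: distrib_left distrib_right power2_eq_square ac_simps)
    also have "\<dots> = recip_poly_fn ([:0, 1:] * q) +
        recip_poly_fn (p * [:1, a2, a4, a6:] + q * [:0, a1, a3:]) * z"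
      unfolding z const_fn_eval.hom_mult const_fn_eval.hom_add
      by (simp only: distrib_left distrib_right ac_simps)
    finally show "recip_poly_fn (d * [:1, a2, a4, a6:]) * (x_fn / y_fn E * g) =
        recip_poly_fn ([:0, 1:] * q) +
        recip_poly_fn (p * [:1, a2, a4, a6:] + q * [:0, a1, a3:]) * (x_fn / y_fn E)"
      by (simp only: z_def)
  qed
qed

lemma expands_at_infinity_mult_w:
  assumes "expands_at_infinity E g k"
  shows "expands_at_infinity E (1 / y_fn E * g) 0"
proof -
  obtain d p q where d: "poly d 0 = 1"
    and eq: "recip_poly_fn d * (x_fn / y_fn E * g) =
      recip_poly_fn p + recip_poly_fn q * (x_fn / y_fn E)"
    using expands_at_infinity_mult_z[OF assms] unfolding expands_at_infinity_def by blast
  show ?thesis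
  proof (rule expands_at_infinityI)
    show "poly d 0 = 1" "poly ([:0, 1:] * p) 0 = 0"
      using d by simp_all
    have "1 / y_fn E = inverse x_fn * (x_fn / y_fn E)"
      by simp
    hence "recip_poly_fn d * (1 / y_fn E * g) =
        inverse x_fn * (recip_poly_fn d * (x_fn / y_fn E * g))"
      by (simp only: ac_simps)
    also have "\<dots> = recip_poly_fn ([:0, 1:] * p) + recip_poly_fn ([:0, 1:] * q) * (x_fn / y_fn E)"
      unfolding eq by (simp add: distrib_left)
    finally show "recip_poly_fn d * (1 / y_fn E * g) =
        recip_poly_fn ([:0, 1:] * p) + recip_poly_fn ([:0, 1:] * q) * (x_fn / y_fn E)" .
  qed
qed

lemma expands_at_infinity_eval2:
  "expands_at_infinity E (eval2 const_fn g (x_fn / y_fn E, 1 / y_fn E)) (poly (poly g 0) 0)"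
proof -
  have poly_in_z: "expands_at_infinity E (eval_poly const_fn p (x_fn / y_fn E)) (poly p 0)" for p
  proof (induction p)
    case 0
    show ?case using expands_at_infinity_const[of E 0] by simp
  next
    case (pCons k p)
    thus ?case
      using expands_at_infinity_add[OF expands_at_infinity_const expands_at_infinity_mult_z]
      by fastforce
  qed
  show ?thesis
  proof (induction g)
    case 0
    show ?case using expands_at_infinity_const[of E 0] by (simp add: eval2_eq_eval_poly)
  next
    case (pCons c g)
    thus ?case
      using expands_at_infinity_add[OF poly_in_z expands_at_infinity_mult_w]
      by (fastforce simp: eval2_eq_eval_poly)
  qed
qed

lemma eval_poly_const_fn_reflect_poly:
  assumes "u \<noteq> 0"
  shows "eval_poly const_fn (reflect_poly p) u = u ^ degree p * eval_poly const_fn p (inverse u)"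
proof -
  have "map_poly const_fn (reflect_poly p) = reflect_poly (map_poly const_fn p)"
    by (rule poly_eqI) (auto simp: coeff_map_poly coeff_reflect_poly degree_map_poly)
  thus ?thesis
    using assms by (simp add: eval_poly_def poly_reflect_poly_nz degree_map_poly)
qed

lemma expands_at_infinity_0D:
  assumes "expands_at_infinity E 0 k"
  shows "k = 0"
proof -
  obtain p q where p0: "poly p 0 = k"
      and expansion: "recip_poly_fn p + recip_poly_fn q * (x_fn / y_fn E) = 0"
    using assms unfolding expands_at_infinity_def by auto
  have "recip_poly_fn p * y_fn E + recip_poly_fn q * x_fn =
      (recip_poly_fn p + recip_poly_fn q * (x_fn / y_fn E)) * y_fn E"
    by (simp add: distrib_right)
  hence "recip_poly_fn p * y_fn E + recip_poly_fn q * x_fn = 0"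
    unfolding expansion by simp
  moreover have "poly_fn ([:0, 1:] ^ Suc (degree p) * reflect_poly q) +
      poly_fn ([:0, 1:] ^ degree q * reflect_poly p) * y_fn E =
      x_fn ^ degree p * x_fn ^ degree q * (recip_poly_fn p * y_fn E + recip_poly_fn q * x_fn)"
    by (simp add: eval_poly_const_fn_reflect_poly algebra_simps)
  ultimately have "poly_fn ([:0, 1:] ^ Suc (degree p) * reflect_poly q) +
      poly_fn ([:0, 1:] ^ degree q * reflect_poly p) * y_fn E = 0"
    by simp
  hence "[:0, 1:] ^ degree q * reflect_poly p = 0"
    by (rule y_fn_independent(2))
  thus ?thesis using p0 by simp
qed

text \<open>
  This makes the value of a function at a point unique, and it excludes the junk value \<open>g / 0\<close>,
  where \<open>0\<close> is the zero function, in \<open>has_value_at\<close>.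
\<close>

lemma chart_eq_0_imp:
  assumes "on_curve (map_curve to_ac E) Q" "eval2 const_fn g (chart E Q) = 0"
  shows "eval2 to_ac g (chart_value Q) = 0"
proof (cases Q)
  case Infinity
  hence "poly (poly g 0) 0 = 0"
    using expands_at_infinity_eval2[of E g] assms(2) expands_at_infinity_0D by force
  moreover have "eval2 to_ac g (0, 0) = to_ac (poly (poly g 0) 0)"
    by (simp add: eval2_def poly_0_coeff_0 coeff_map_poly)
  ultimately show ?thesis using Infinity by simp
next
  case (Affine u v)
  thus ?thesis using assms affine_chart_eq_0_imp by fastforce
qed

lemma comm_ring_hom_eval2:
  assumes "comm_ring_hom h"
  shows "comm_ring_hom (\<lambda>g. eval2 h g w)"
  using comm_ring_hom.comm_ring_hom_eval_poly[OF comm_ring_hom.comm_ring_hom_eval_poly[OF assms]]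
  by (cases w) (simp add: eval2_eq_eval_poly)

interpretation to_ac_eval2: comm_ring_hom "\<lambda>g. eval2 to_ac g w" for w
  by (rule comm_ring_hom_eval2) (rule to_ac.comm_ring_hom_axioms)

interpretation const_fn_eval2: comm_ring_hom "\<lambda>g. eval2 const_fn g w" for w
  by (rule comm_ring_hom_eval2) (rule const_fn.comm_ring_hom_axioms)

context
  fixes E :: "'k::field curve" and Q :: "'k alg_closure point"
  assumes Q: "on_curve (map_curve to_ac E) Q"
begin

lemma has_value_at_iff:
  "has_value_at E f Q k \<longleftrightarrow>
    (\<exists>g h. eval2 to_ac h (chart_value Q) \<noteq> 0 \<and>
      f * eval2 const_fn h (chart E Q) = eval2 const_fn g (chart E Q) \<and>
      k * eval2 to_ac h (chart_value Q) = eval2 to_ac g (chart_value Q))"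
proof -
  have "f = eval2 const_fn g (chart E Q) / eval2 const_fn h (chart E Q) \<longleftrightarrow>
      f * eval2 const_fn h (chart E Q) = eval2 const_fn g (chart E Q)"
    if "eval2 to_ac h (chart_value Q) \<noteq> 0" for g h
    using chart_eq_0_imp[OF Q, of h] that by (auto simp: eq_divide_eq)
  thus ?thesis
    unfolding has_value_at_def by (metis (no_types, lifting) eq_divide_eq)
qed

lemma has_value_at_eval2:
  "has_value_at E (eval2 const_fn g (chart E Q)) Q (eval2 to_ac g (chart_value Q))"
  unfolding has_value_at_iff by (intro exI[of _ g] exI[of _ 1]) simp

lemma has_value_at_const: "has_value_at E (const_fn k) Q (to_ac k)"
  using has_value_at_eval2[of "[:[:k:]:]"]
  by (cases "chart E Q"; cases "chart_value Q") (simp add: eval2_eq_eval_poly)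

lemma has_value_at_fst_chart: "has_value_at E (fst (chart E Q)) Q (fst (chart_value Q))"
  using has_value_at_eval2[of "[:[:0, 1:]:]"]
  by (cases "chart E Q"; cases "chart_value Q") (simp add: eval2_eq_eval_poly)

lemma has_value_at_snd_chart: "has_value_at E (snd (chart E Q)) Q (snd (chart_value Q))"
  using has_value_at_eval2[of "[:0, 1:]"]
  by (cases "chart E Q"; cases "chart_value Q") (simp add: eval2_eq_eval_poly)

lemma has_value_at_add_mult:
  assumes "has_value_at E f Q k" "has_value_at E f' Q k'"
  shows has_value_at_add: "has_value_at E (f + f') Q (k + k')"
    and has_value_at_mult: "has_value_at E (f * f') Q (k * k')"
proof -
  obtain g h g' h' where h: "eval2 to_ac h (chart_value Q) \<noteq> 0" "eval2 to_ac h' (chart_value Q) \<noteq> 0"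
    and f: "eval2 const_fn g (chart E Q) = f * eval2 const_fn h (chart E Q)"
      "eval2 const_fn g' (chart E Q) = f' * eval2 const_fn h' (chart E Q)"
    and k: "eval2 to_ac g (chart_value Q) = k * eval2 to_ac h (chart_value Q)"
      "eval2 to_ac g' (chart_value Q) = k' * eval2 to_ac h' (chart_value Q)"
    using assms unfolding has_value_at_iff by metis
  show "has_value_at E (f + f') Q (k + k')"
    unfolding has_value_at_iff
    by (intro exI[of _ "g * h' + g' * h"] exI[of _ "h * h'"]) (simp add: h f k algebra_simps)
  show "has_value_at E (f * f') Q (k * k')"
    unfolding has_value_at_iff
    by (intro exI[of _ "g * g'"] exI[of _ "h * h'"]) (simp add: h f k algebra_simps)
qed

lemma has_value_at_inverse:
  assumes "has_value_at E f Q k" "k \<noteq> 0"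
  shows "has_value_at E (inverse f) Q (inverse k)"
proof -
  obtain g h where h: "eval2 to_ac h (chart_value Q) \<noteq> 0"
    and f: "f * eval2 const_fn h (chart E Q) = eval2 const_fn g (chart E Q)"
    and k: "k * eval2 to_ac h (chart_value Q) = eval2 to_ac g (chart_value Q)"
    using assms(1) unfolding has_value_at_iff by blast
  have "eval2 to_ac g (chart_value Q) \<noteq> 0"
    using h \<open>k \<noteq> 0\<close> by (simp flip: k)
  moreover from this have "f \<noteq> 0"
    using chart_eq_0_imp[OF Q, of g] f by auto
  ultimately show ?thesis
    unfolding has_value_at_iff using \<open>k \<noteq> 0\<close>
    by (intro exI[of _ h] exI[of _ g]) (simp flip: f k)
qed

lemma has_value_at_divide:
  "has_value_at E f Q k \<Longrightarrow> has_value_at E f' Q k' \<Longrightarrow> k' \<noteq> 0 \<Longrightarrow> has_value_at E (f / f') Q (k / k')"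
  unfolding divide_inverse by (intro has_value_at_mult has_value_at_inverse)

lemma has_value_at_diff:
  assumes "has_value_at E f Q k" "has_value_at E f' Q k'"
  shows "has_value_at E (f - f') Q (k - k')"
  using has_value_at_add[OF assms(1) has_value_at_mult[OF has_value_at_const[of "-1"] assms(2)]]
  by simp

lemma has_value_at_power: "has_value_at E f Q k \<Longrightarrow> has_value_at E (f ^ n) Q (k ^ n)"
  using has_value_at_const[of 1] by (induction n) (auto intro: has_value_at_mult)

lemma has_value_at_eval_poly:
  "has_value_at E f Q k \<Longrightarrow> has_value_at E (eval_poly const_fn p f) Q (eval_poly to_ac p k)"
  using has_value_at_const[of 0]
  by (induction p) (auto intro!: has_value_at_add has_value_at_mult has_value_at_const)

lemmas has_value_at_intros =
  has_value_at_add has_value_at_diff has_value_at_mult has_value_at_power has_value_at_eval_poly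
  has_value_at_const

end

lemma has_value_at_affine:
  assumes "on_curve (map_curve to_ac E) (Affine u v)"
  shows "has_value_at E x_fn (Affine u v) u" "has_value_at E (y_fn E) (Affine u v) v"
  using has_value_at_fst_chart[OF assms] has_value_at_snd_chart[OF assms] by simp_all

lemma has_value_at_Infinity:
  "has_value_at E (x_fn / y_fn E) Infinity 0" "has_value_at E (1 / y_fn E) Infinity 0"
  using has_value_at_fst_chart[of E Infinity] has_value_at_snd_chart[of E Infinity] by simp_all

lemma unit_at_infinity_eq:
  fixes x y :: "'a::field"
  assumes "y \<noteq> 0" and "y\<^sup>2 = a6 + x * (a4 + x * (a2 + x)) - (a3 + x * a1) * y"
  shows "(1 + a1 * (x / y) + a3 * (1 / y) - a2 * (x / y)\<^sup>2 - a4 * (x / y * (1 / y))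
    - a6 * (1 / y)\<^sup>2) * y\<^sup>2 = x ^ 3"
proof -
  have "(1 + a1 * (x / y) + a3 * (1 / y) - a2 * (x / y)\<^sup>2 - a4 * (x / y * (1 / y))
    - a6 * (1 / y)\<^sup>2) * y\<^sup>2 = y\<^sup>2 + a1 * x * y + a3 * y - a2 * x\<^sup>2 - a4 * x - a6"
    using assms(1) by (simp add: field_simps power2_eq_square)
  also have "\<dots> = x ^ 3"
    unfolding assms(2) by (simp add: algebra_simps power2_eq_square power3_eq_cube)
  finally show ?thesis .
qed

text \<open>By the equation of the curve, \<open>1/x\<close> is \<open>(x/y)\<^sup>2\<close> divided by a unit at infinity.\<close>

lemma inverse_x_fn_at_Infinity: "has_value_at E (inverse x_fn) Infinity 0"
proof -
  obtain a1 a2 a3 a4 a6 where E: "E = Weierstrass a1 a2 a3 a4 a6" by (cases E)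
  define z w where "z = x_fn / y_fn E" and "w = 1 / y_fn E"
  define u where "u = const_fn 1 + const_fn a1 * z + const_fn a3 * w - const_fn a2 * z\<^sup>2
    - const_fn a4 * (z * w) - const_fn a6 * w\<^sup>2"
  have on_curve: "on_curve (map_curve to_ac E) Infinity" by simp
  have z: "has_value_at E z Infinity 0" and "has_value_at E w Infinity 0"
    unfolding z_def w_def by (rule has_value_at_Infinity)+
  hence "has_value_at E u Infinity (to_ac 1 + to_ac a1 * 0 + to_ac a3 * 0 - to_ac a2 * 0\<^sup>2
      - to_ac a4 * (0 * 0) - to_ac a6 * 0\<^sup>2)"
    unfolding u_def by (intro has_value_at_intros[OF on_curve])
  hence u: "has_value_at E u Infinity 1" by simp
  have "(y_fn E)\<^sup>2 = const_fn a6 + x_fn * (const_fn a4 + x_fn * (const_fn a2 + x_fn))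
      - (const_fn a3 + x_fn * const_fn a1) * y_fn E"
    using y_fn_squared[of a1 a2 a3 a4 a6] by (simp add: E)
  hence "u * (y_fn E)\<^sup>2 = x_fn ^ 3"
    unfolding u_def z_def w_def const_fn.hom_1 by (rule unit_at_infinity_eq[OF y_fn_neq_0])
  hence "inverse x_fn = z\<^sup>2 / u"
    by (auto simp: z_def divide_simps power2_eq_square power3_eq_cube mult_ac)
  thus ?thesis
    using has_value_at_divide[OF on_curve has_value_at_power[OF on_curve z, of 2] u] by simp
qed

lemma poly_fn_at_Infinity:
  "has_value_at E (poly_fn p / x_fn ^ degree p) Infinity (to_ac (lead_coeff p))"
proof -
  have "poly_fn p / x_fn ^ degree p = recip_poly_fn (reflect_poly p)"
    by (simp add: eval_poly_const_fn_reflect_poly power_inverse divide_inverse mult.commute)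
  moreover have "eval_poly to_ac (reflect_poly p) 0 = to_ac (lead_coeff p)"
    by (simp add: eval_poly_def poly_0_coeff_0 coeff_map_poly)
  ultimately show ?thesis
    using has_value_at_eval_poly[OF _ inverse_x_fn_at_Infinity, of E "reflect_poly p"] by simp
qed

section \<open>Changes of coordinates\<close>

text \<open>
  The substitution is \<open>x = x' + r\<close>, \<open>y = y' + s x' + t\<close>: \<open>change_curve r s t E\<close> is the curve in the
  coordinates \<open>x'\<close>, \<open>y'\<close>.
\<close>

fun change_curve :: "'a::comm_ring_1 \<Rightarrow> 'a \<Rightarrow> 'a \<Rightarrow> 'a curve \<Rightarrow> 'a curve" where
  "change_curve r s t (Weierstrass a1 a2 a3 a4 a6) =
     Weierstrass (a1 + 2 * s) (a2 - s * a1 + 3 * r - s\<^sup>2) (a3 + r * a1 + 2 * t)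
       (a4 - s * a3 + 2 * r * a2 - (t + r * s) * a1 + 3 * r\<^sup>2 - 2 * s * t)
       (a6 + r * a4 + r\<^sup>2 * a2 + r ^ 3 - t * a3 - t\<^sup>2 - r * t * a1)"

fun change_point :: "'a::comm_ring_1 \<Rightarrow> 'a \<Rightarrow> 'a \<Rightarrow> 'a point \<Rightarrow> 'a point" where
  "change_point r s t Infinity = Infinity"
| "change_point r s t (Affine x y) = Affine (x - r) (y - s * (x - r) - t)"

lemma change_curve_inverse: "change_curve (- r) (- s) (r * s - t) (change_curve r s t E) = E"
  by (cases E) (simp add: algebra_simps power2_eq_square power3_eq_cube)

lemma change_point_inverse: "change_point (- r) (- s) (r * s - t) (change_point r s t P) = P"
  by (cases P) (simp_all add: algebra_simps)

lemma map_curve_change_curve: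
  assumes "comm_ring_hom h"
  shows "map_curve h (change_curve r s t E) = change_curve (h r) (h s) (h t) (map_curve h E)"
proof -
  interpret comm_ring_hom h by fact
  show ?thesis by (cases E) simp
qed

lemma map_point_change_point:
  assumes "comm_ring_hom h"
  shows "map_point h (change_point r s t P) = change_point (h r) (h s) (h t) (map_point h P)"
proof -
  interpret comm_ring_hom h by fact
  show ?thesis by (cases P) simp_all
qed

lemma on_curve_map:
  assumes "comm_ring_hom h" "on_curve E P"
  shows "on_curve (map_curve h E) (map_point h P)"
proof -
  interpret comm_ring_hom h by fact
  show ?thesis
  proof (cases E; cases P)
    fix a1 a2 a3 a4 a6 x y
    assume E: "E = Weierstrass a1 a2 a3 a4 a6" and P: "P = Affine x y"
    have "h (y\<^sup>2 + a1 * x * y + a3 * y) = h (x ^ 3 + a2 * x\<^sup>2 + a4 * x + a6)"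
      using assms(2) by (simp only: E P on_curve.simps)
    thus ?thesis by (simp add: E P)
  qed simp_all
qed

lemma on_curve_change:
  fixes E :: "'a::field curve"
  shows "on_curve E P \<Longrightarrow> on_curve (change_curve r s t E) (change_point r s t P)"
  by (cases E; cases P) (simp_all add: algebra_simps power2_eq_square power3_eq_cube)

lemma discriminant_change_curve: "discriminant (change_curve r s t E) = discriminant E"
proof (cases E)
  case (Weierstrass a1 a2 a3 a4 a6)
  show ?thesis
    unfolding Weierstrass change_curve.simps discriminant.simps Let_def by Groebner_Basis.algebra
qed

lemma elliptic_curve_change_curve:
  "elliptic_curve (change_curve r s t E) \<longleftrightarrow> elliptic_curve E"
  by (simp add: elliptic_curve_def discriminant_change_curve)

lemma point_double_eq_Infinity_iff:
  "point_add (Weierstrass a1 a2 a3 a4 a6) (Affine x y) (Affine x y) = Infinity \<longleftrightarrow>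
    2 * y + a1 * x + a3 = 0"
  by (simp add: Let_def flip: mult_2)

lemma point_double_slope:
  fixes m :: "'a::field"
  assumes "2 * y + a1 * x + a3 \<noteq> 0" "m * (2 * y + a1 * x + a3) = 3 * x\<^sup>2 + 2 * a2 * x + a4 - a1 * y"
    and "x3 = m\<^sup>2 + a1 * m - a2 - 2 * x"
  shows "point_add (Weierstrass a1 a2 a3 a4 a6) (Affine x y) (Affine x y) =
    Affine x3 (- (y + m * (x3 - x)) - a1 * x3 - a3)"
proof -
  have "y + y + a1 * x + a3 \<noteq> 0" "x3 = m\<^sup>2 + a1 * m - a2 - x - x"
    using assms(1,3) by (simp_all flip: mult_2)
  moreover have "(3 * x\<^sup>2 + 2 * a2 * x + a4 - a1 * y) / (2 * y + a1 * x + a3) = m"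
    using assms(1,2) by (simp add: divide_eq_eq)
  ultimately show ?thesis by (simp add: Let_def)
qed

lemma tangent_change:
  fixes x y a1 a2 a3 a4 r s t :: "'a::comm_ring_1"
  defines "d \<equiv> 2 * y + a1 * x + a3" and "x' \<equiv> x - r" and "y' \<equiv> y - s * (x - r) - t"
  shows "2 * y' + (a1 + 2 * s) * x' + (a3 + r * a1 + 2 * t) = d"
    and "3 * x'\<^sup>2 + 2 * (a2 - s * a1 + 3 * r - s\<^sup>2) * x'
      + (a4 - s * a3 + 2 * r * a2 - (t + r * s) * a1 + 3 * r\<^sup>2 - 2 * s * t) - (a1 + 2 * s) * y' =
      3 * x\<^sup>2 + 2 * a2 * x + a4 - a1 * y - s * d"
  by (simp_all add: d_def x'_def y'_def algebra_simps power2_eq_square)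

lemma point_double_change:
  fixes E :: "'a::field curve"
  shows "point_add (change_curve r s t E) (change_point r s t P) (change_point r s t P) =
    change_point r s t (point_add E P P)"
proof (cases E; cases P)
  fix a1 a2 a3 a4 a6 x y
  assume E: "E = Weierstrass a1 a2 a3 a4 a6" and P: "P = Affine x y"
  let ?E' = "change_curve r s t E" and ?P' = "change_point r s t P"
  show ?thesis
  proof (cases "2 * y + a1 * x + a3 = 0")
    case True
    have "point_add E P P = Infinity" "point_add ?E' ?P' ?P' = Infinity"
      unfolding E P change_curve.simps change_point.simps point_double_eq_Infinity_iff
        tangent_change
      by (rule True)+
    thus ?thesis by simp
  next
    case False
    define m where "m = (3 * x\<^sup>2 + 2 * a2 * x + a4 - a1 * y) / (2 * y + a1 * x + a3)"
    define x3 where "x3 = m\<^sup>2 + a1 * m - a2 - 2 * x"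
    have m: "m * (2 * y + a1 * x + a3) = 3 * x\<^sup>2 + 2 * a2 * x + a4 - a1 * y"
      using False by (simp add: m_def)
    have "x3 - r = (m - s)\<^sup>2 + (a1 + 2 * s) * (m - s) - (a2 - s * a1 + 3 * r - s\<^sup>2) - 2 * (x - r)"
      by (simp add: x3_def algebra_simps power2_eq_square)
    hence "point_add ?E' ?P' ?P' =
        Affine (x3 - r) (- (y - s * (x - r) - t + (m - s) * (x3 - r - (x - r)))
          - (a1 + 2 * s) * (x3 - r) - (a3 + r * a1 + 2 * t))"
      unfolding E P change_curve.simps change_point.simps
      by (intro point_double_slope)
        (simp_all only: tangent_change False m left_diff_distrib not_False_eq_True)
    moreover have "point_add E P P = Affine x3 (- (y + m * (x3 - x)) - a1 * x3 - a3)"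
      unfolding E P using False m x3_def by (rule point_double_slope)
    ultimately show ?thesis
      by (simp add: algebra_simps)
  qed
qed simp_all

lemma set_change_point_subset:
  fixes L :: "'a::field set"
  assumes "subfield L ring_of_type_algebra" "{r, s, t} \<subseteq> L" "set_point P \<subseteq> L"
  shows "set_point (change_point r s t P) \<subseteq> L"
  using assms by (cases P) (auto intro!: subfield_type_algebraD[OF assms(1)])

lemma magnified_by_doubling_change:
  assumes "magnified_by_doubling E P"
  shows "magnified_by_doubling (change_curve r s t E) (change_point r s t P)"
proof -
  let ?change = "change_point (to_ac r) (to_ac s) (to_ac t)"
  obtain L R where L: "finite_field_extension (range to_ac) L"
      "extension_degree (range to_ac) L < 4"
    and R: "R \<in> points_over (map_curve to_ac E) L"
      "point_add (map_curve to_ac E) R R = map_point to_ac P"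
    using assms unfolding magnified_by_doubling_def by blast
  have "set_point (?change R) \<subseteq> L"
    using L(1) R(1)
    by (intro set_change_point_subset) (auto simp: finite_field_extension_def points_over_def)
  hence "?change R \<in> points_over (map_curve to_ac (change_curve r s t E)) L"
    using R(1)
    by (simp add: points_over_def on_curve_change
        map_curve_change_curve[OF to_ac.comm_ring_hom_axioms])
  moreover have "point_add (map_curve to_ac (change_curve r s t E)) (?change R) (?change R) =
      map_point to_ac (change_point r s t P)"
    unfolding map_curve_change_curve[OF to_ac.comm_ring_hom_axioms] point_double_change R(2)
      map_point_change_point[OF to_ac.comm_ring_hom_axioms] ..
  ultimately show ?thesis
    unfolding magnified_by_doubling_def using L by blast
qed

abbreviation change_ambient ::
    "'k::field \<Rightarrow> 'k \<Rightarrow> 'k \<Rightarrow> 'k ambient point \<Rightarrow> 'k ambient point" where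
  "change_ambient r s t \<equiv> change_point (const_fn r) (const_fn s) (const_fn t)"

lemma rational_map_change:
  assumes "rational_map E' E \<phi>"
  shows "rational_map E' (change_curve r s t E) (change_ambient r s t \<phi>)"
  using assms function_field_generators(1)[of _ E']
    set_change_point_subset[OF subfield_function_field, of "const_fn r" "const_fn s" "const_fn t"]
  by (simp add: rational_map_def points_over_def on_curve_change
      map_curve_change_curve[OF const_fn.comm_ring_hom_axioms])

lemma proj_coords_change_point:
  "proj_coords (change_point r s t P) =
    (case proj_coords P of (u, v, w) \<Rightarrow> (u - r * w, v - s * (u - r * w) - t * w, w))"
  by (cases P) simp_all

lemma maps_to_change:
  assumes "on_curve (map_curve to_ac E') Q" "maps_to E' \<phi> Q P"
  shows "maps_to E' (change_ambient r s t \<phi>) Q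
    (change_point (to_ac r) (to_ac s) (to_ac t) P)"
proof -
  obtain f g h u v w where \<phi>: "proj_coords \<phi> = (f, g, h)" and P: "proj_coords P = (u, v, w)"
    by (metis prod_cases3)
  obtain c k where c: "c \<in> function_field E'" and k: "k \<noteq> 0"
    and fgh: "has_value_at E' (c * f) Q (k * u)" "has_value_at E' (c * g) Q (k * v)"
      "has_value_at E' (c * h) Q (k * w)"
    using assms(2) unfolding maps_to_def \<phi> P by auto
  have abscissa: "has_value_at E' (c * f - const_fn r * (c * h)) Q (k * u - to_ac r * (k * w))"
    by (intro has_value_at_intros[OF assms(1)] fgh)
  have ordinate: "has_value_at E'
      (c * g - const_fn s * (c * f - const_fn r * (c * h)) - const_fn t * (c * h)) Q
      (k * v - to_ac s * (k * u - to_ac r * (k * w)) - to_ac t * (k * w))"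
    by (intro has_value_at_intros[OF assms(1)] fgh abscissa)
  show ?thesis
    unfolding maps_to_def proj_coords_change_point \<phi> P using c k fgh(3) abscissa ordinate
    by (intro bexI[of _ c] exI[of _ k]) (simp_all add: algebra_simps)
qed

lemma morphism_change:
  assumes "morphism E' E \<phi>"
  shows "morphism E' (change_curve r s t E) (change_ambient r s t \<phi>)"
  using assms unfolding morphism_def map_curve_change_curve[OF to_ac.comm_ring_hom_axioms]
  by (blast intro: rational_map_change on_curve_change maps_to_change)

lemma isogeny_change:
  assumes "isogeny E' E \<phi>"
  shows "isogeny E' (change_curve r s t E) (change_ambient r s t \<phi>)"
  unfolding isogeny_def
proof (intro conjI notI)
  let ?\<phi> = "change_ambient r s t \<phi>"
  show "morphism E' (change_curve r s t E) ?\<phi>"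
    using assms by (simp add: isogeny_def morphism_change)
  show "maps_to E' ?\<phi> Infinity Infinity"
    using assms maps_to_change[of E' Infinity \<phi> Infinity] by (simp add: isogeny_def)
  assume "?\<phi> \<in> range (map_point const_fn)"
  then obtain P where "?\<phi> = map_point const_fn P" ..
  hence "\<phi> = map_point const_fn (change_point (- r) (- s) (r * s - t) P)"
    using change_point_inverse[of "const_fn r" "const_fn s" "const_fn t" \<phi>]
    by (simp add: map_point_change_point[OF const_fn.comm_ring_hom_axioms])
  thus False using assms by (simp add: isogeny_def)
qed

abbreviation pullback_field :: "'k::field ambient point \<Rightarrow> 'k ambient set" where
  "pullback_field \<phi> \<equiv> generate_field ring_of_type_algebra (range const_fn \<union> set_point \<phi>)"

lemma pullback_field_change_subset:
  "pullback_field (change_ambient r s t \<phi>) \<subseteq> pullback_field \<phi>"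
proof (rule generate_field_subset[OF subfield_generate_field])
  have "range const_fn \<union> set_point \<phi> \<subseteq> pullback_field \<phi>"
    by (auto intro: generate_field.incl)
  thus "range const_fn \<union> set_point (change_ambient r s t \<phi>) \<subseteq> pullback_field \<phi>"
    using set_change_point_subset[OF subfield_generate_field,
        of "const_fn r" "const_fn s" "const_fn t"]
    by blast
qed

lemma isogeny_degree_change:
  "isogeny_degree E' (change_ambient r s t \<phi>) = isogeny_degree E' \<phi>"
proof -
  let ?\<phi> = "change_ambient r s t \<phi>"
  have "\<phi> = change_ambient (- r) (- s) (r * s - t) ?\<phi>"
    by (simp add: change_point_inverse)
  hence "pullback_field \<phi> \<subseteq> pullback_field ?\<phi>"
    using pullback_field_change_subset by metis
  hence "pullback_field ?\<phi> = pullback_field \<phi>"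
    using pullback_field_change_subset by blast
  thus ?thesis by (simp add: isogeny_degree_def)
qed

theorem K_magnified_change:
  assumes "K_magnified E P"
  shows "K_magnified (change_curve r s t E) (change_point r s t P)"
proof -
  obtain E' \<phi> Q where E': "elliptic_curve E'" "on_curve E' Q"
    and \<phi>: "isogeny E' E \<phi>" "isogeny_degree E' \<phi> > 1"
      "maps_to E' \<phi> (map_point to_ac Q) (map_point to_ac P)"
    using assms unfolding K_magnified_def by blast
  have "on_curve (map_curve to_ac E') (map_point to_ac Q)"
    using E'(2) by (rule on_curve_map[OF to_ac.comm_ring_hom_axioms])
  thus ?thesis
    unfolding K_magnified_def map_point_change_point[OF to_ac.comm_ring_hom_axioms]
    using E' \<phi> isogeny_change isogeny_degree_change maps_to_change by metis
qed

section \<open>Isogenies between short Weierstrass curves\<close>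

abbreviation short_curve :: "'a::zero \<Rightarrow> 'a \<Rightarrow> 'a \<Rightarrow> 'a curve" where
  "short_curve a b c \<equiv> Weierstrass 0 a 0 b c"

abbreviation cubic :: "'a::comm_ring_1 \<Rightarrow> 'a \<Rightarrow> 'a \<Rightarrow> 'a poly" where
  "cubic a b c \<equiv> [:c, b, a, 1:]"

lemma on_curve_map_short_curve_iff:
  assumes "comm_ring_hom h"
  shows "on_curve (map_curve h (short_curve a b c)) (Affine u v) \<longleftrightarrow>
    v\<^sup>2 = eval_poly h (cubic a b c) u"
proof -
  interpret comm_ring_hom h by fact
  show ?thesis unfolding on_curve_map_curve_iff[OF assms] by simp
qed

lemma on_short_curve_iff:
  "on_curve (short_curve a b c) (Affine u v) \<longleftrightarrow> v\<^sup>2 = poly (cubic a b c) u"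
  using on_curve_map_short_curve_iff[OF comm_ring_hom_id, of a b c u v]
  by (simp add: curve.map_ident eval_poly_id del: on_curve.simps)

text \<open>
  The isogeny is \<open>X = N(x) / D(x)\<close>, \<open>Y = y M(x) / D(x)\<^sup>2\<close>. The factor \<open>G\<close> serves to rewrite it near
  the zeros of \<open>D\<close> as \<open>X = N G / y\<^sup>2\<close>, \<open>Y = M G\<^sup>2 / y\<^sup>3\<close>.
\<close>

locale isogeny_formula =
  fixes a b c A B C :: "'k::field" and N D M G :: "'k poly"
  assumes cubic_factorization: "cubic a b c = D * G"
    and target_equation: "M\<^sup>2 * G = N ^ 3 + [:A:] * N\<^sup>2 * D + [:B:] * N * D\<^sup>2 + [:C:] * D ^ 3"
    and degree_D: "degree D > 0"
    and degree_N: "degree N = degree D + 1"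
    and degree_M: "degree M = 2 * degree D"
    and no_common_root: "\<And>z. eval_poly to_ac D z = 0 \<Longrightarrow> eval_poly to_ac N z \<noteq> 0"
begin

abbreviation source :: "'k curve" where "source \<equiv> short_curve a b c"
abbreviation target :: "'k curve" where "target \<equiv> short_curve A B C"
abbreviation y :: "'k ambient" where "y \<equiv> y_fn source"

definition X_fn :: "'k ambient" where "X_fn = poly_fn N / poly_fn D"
definition Y_fn :: "'k ambient" where "Y_fn = y * poly_fn M / (poly_fn D)\<^sup>2"
definition \<phi> :: "'k ambient point" where "\<phi> = Affine X_fn Y_fn"

lemma polys_neq_0 [simp]: "D \<noteq> 0" "N \<noteq> 0" "M \<noteq> 0"
  using degree_D degree_N degree_M by auto

lemma y_squared: "y\<^sup>2 = poly_fn D * poly_fn G"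
  using y_fn_squared[of 0 a 0 b c] cubic_factorization by (simp flip: const_fn_eval.hom_mult)

lemma eval_target_equation:
  assumes "comm_ring_hom h"
  shows "(eval_poly h M u)\<^sup>2 * eval_poly h G u = eval_poly h N u ^ 3
    + h A * (eval_poly h N u)\<^sup>2 * eval_poly h D u
    + h B * eval_poly h N u * (eval_poly h D u)\<^sup>2 + h C * eval_poly h D u ^ 3"
proof -
  interpret h: comm_ring_hom h by fact
  interpret comm_ring_hom "\<lambda>p. eval_poly h p u" by (rule h.comm_ring_hom_eval_poly)
  have "eval_poly h (M\<^sup>2 * G) u =
      eval_poly h (N ^ 3 + [:A:] * N\<^sup>2 * D + [:B:] * N * D\<^sup>2 + [:C:] * D ^ 3) u"
    by (simp only: target_equation)
  thus ?thesis by simp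
qed

lemma formula_on_target:
  fixes h :: "'k \<Rightarrow> 'b::field"
  assumes h: "comm_ring_hom h" and source: "on_curve (map_curve h source) (Affine u v)"
    and D: "eval_poly h D u \<noteq> 0"
  shows "on_curve (map_curve h target)
    (Affine (eval_poly h N u / eval_poly h D u) (v * eval_poly h M u / (eval_poly h D u)\<^sup>2))"
proof -
  interpret h: comm_ring_hom h by fact
  interpret comm_ring_hom "\<lambda>p. eval_poly h p u" by (rule h.comm_ring_hom_eval_poly)
  have v: "v\<^sup>2 = eval_poly h D u * eval_poly h G u"
    using source unfolding on_curve_map_short_curve_iff[OF h] cubic_factorization by simp
  have "(v * eval_poly h M u / (eval_poly h D u)\<^sup>2)\<^sup>2 =
      v\<^sup>2 * (eval_poly h M u)\<^sup>2 / eval_poly h D u ^ 4"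
    by (simp add: power_divide power_mult_distrib flip: power_mult)
  also have "\<dots> = (eval_poly h M u)\<^sup>2 * eval_poly h G u / eval_poly h D u ^ 3"
    using D unfolding v by (simp add: eval_nat_numeral)
  also have "\<dots> = eval_poly h (cubic A B C) (eval_poly h N u / eval_poly h D u)"
    unfolding eval_target_equation[OF h] using D by (simp add: field_simps eval_nat_numeral)
  finally show ?thesis unfolding on_curve_map_short_curve_iff[OF h] .
qed

lemma \<phi>_on_target: "on_curve (map_curve const_fn target) \<phi>"
  unfolding \<phi>_def X_fn_def Y_fn_def
  by (intro formula_on_target const_fn.comm_ring_hom_axioms y_fn_on_curve) simp

lemma X_fn_Y_fn_in_function_field: "X_fn \<in> function_field source" "Y_fn \<in> function_field source"
  unfolding X_fn_def Y_fn_def by (intro function_field_intros)+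

lemma rational_map_\<phi>: "rational_map source target \<phi>"
  using \<phi>_on_target X_fn_Y_fn_in_function_field
  by (simp add: rational_map_def points_over_def \<phi>_def)

lemma maps_to_\<phi>I:
  assumes "t \<in> function_field source" "k \<noteq> 0" "proj_coords P = (u, v, w)"
    and "has_value_at source (t * X_fn) Q (k * u)" "has_value_at source (t * Y_fn) Q (k * v)"
    and "has_value_at source t Q (k * w)"
  shows "maps_to source \<phi> Q P"
  unfolding maps_to_def using assms by (intro bexI[of _ t] exI[of _ k]) (simp_all add: \<phi>_def)

lemma maps_to_affine:
  fixes z w :: "'k alg_closure"
  defines "u \<equiv> eval_poly to_ac N z / eval_poly to_ac D z"
    and "v \<equiv> w * eval_poly to_ac M z / (eval_poly to_ac D z)\<^sup>2"
  assumes source: "on_curve (map_curve to_ac source) (Affine z w)" and D: "eval_poly to_ac D z \<noteq> 0"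
  shows "maps_to source \<phi> (Affine z w) (Affine u v)"
proof (rule maps_to_\<phi>I[of 1 1])
  note x = has_value_at_affine(1)[OF source] and y = has_value_at_affine(2)[OF source]
  have "has_value_at source X_fn (Affine z w) u"
    unfolding X_fn_def u_def using D
    by (intro has_value_at_divide[OF source] has_value_at_intros[OF source] x)
  thus "has_value_at source (1 * X_fn) (Affine z w) (1 * u)" by simp
  have "has_value_at source Y_fn (Affine z w) v"
    unfolding Y_fn_def v_def using D
    by (intro has_value_at_divide[OF source] has_value_at_intros[OF source] x y) simp
  thus "has_value_at source (1 * Y_fn) (Affine z w) (1 * v)" by simp
  show "has_value_at source 1 (Affine z w) (1 * 1)"
    using has_value_at_const[OF source, of 1] by simp
qed (simp_all add: function_field_intros)

lemma maps_to_pole: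
  assumes source: "on_curve (map_curve to_ac source) (Affine z w)" and D: "eval_poly to_ac D z = 0"
  shows "maps_to source \<phi> (Affine z w) Infinity"
proof (rule maps_to_\<phi>I[of "y ^ 3" "eval_poly to_ac M z * (eval_poly to_ac G z)\<^sup>2"])
  let ?k = "eval_poly to_ac M z * (eval_poly to_ac G z)\<^sup>2"
  have "w\<^sup>2 = 0"
    using source D
    unfolding on_curve_map_short_curve_iff[OF to_ac.comm_ring_hom_axioms] cubic_factorization
    by simp
  hence w: "w = 0" by simp
  have "(eval_poly to_ac M z)\<^sup>2 * eval_poly to_ac G z = eval_poly to_ac N z ^ 3"
    using eval_target_equation[OF to_ac.comm_ring_hom_axioms, of z] D by simp
  thus "?k \<noteq> 0"
    using no_common_root[OF D] by auto
  note x = has_value_at_affine(1)[OF source] and y = has_value_at_affine(2)[OF source]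
  have "y ^ 3 * X_fn = y\<^sup>2 * y * poly_fn N / poly_fn D"
    by (simp add: X_fn_def power2_eq_square power3_eq_cube)
  hence "y ^ 3 * X_fn = y * poly_fn N * poly_fn G"
    by (simp add: y_squared)
  moreover have "has_value_at source (y * poly_fn N * poly_fn G) (Affine z w)
      (w * eval_poly to_ac N z * eval_poly to_ac G z)"
    by (intro has_value_at_intros[OF source] x y)
  ultimately show "has_value_at source (y ^ 3 * X_fn) (Affine z w) (?k * 0)"
    by (simp add: w)
  have "y ^ 3 * Y_fn = y\<^sup>2 * y\<^sup>2 * poly_fn M / (poly_fn D)\<^sup>2"
    by (simp add: Y_fn_def power2_eq_square power3_eq_cube)
  hence "y ^ 3 * Y_fn = poly_fn M * (poly_fn G)\<^sup>2"
    unfolding y_squared by (simp add: power2_eq_square)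
  moreover have "has_value_at source (poly_fn M * (poly_fn G)\<^sup>2) (Affine z w) ?k"
    by (intro has_value_at_intros[OF source] x)
  ultimately show "has_value_at source (y ^ 3 * Y_fn) (Affine z w) (?k * 1)"
    by simp
  show "has_value_at source (y ^ 3) (Affine z w) (?k * 0)"
    using has_value_at_power[OF source y, of 3] by (simp add: w)
qed (simp_all add: function_field_intros)

lemma maps_to_Infinity: "maps_to source \<phi> Infinity Infinity"
proof -
  have source: "on_curve (map_curve to_ac source) Infinity" by simp
  define n d m where "n = poly_fn N / x_fn ^ degree N" and "d = poly_fn D / x_fn ^ degree D"
    and "m = poly_fn M / x_fn ^ degree M"
  have n: "has_value_at source n Infinity (to_ac (lead_coeff N))"
    and d: "has_value_at source d Infinity (to_ac (lead_coeff D))"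
    and m: "has_value_at source m Infinity (to_ac (lead_coeff M))"
    unfolding n_def d_def m_def by (rule poly_fn_at_Infinity)+
  let ?k = "to_ac (lead_coeff M) / (to_ac (lead_coeff D))\<^sup>2"
  show ?thesis
  proof (rule maps_to_\<phi>I[of "1 / y" "?k"])
    have "1 / y * X_fn = x_fn / y * (n / d)"
      by (simp add: X_fn_def n_def d_def degree_N)
    moreover have "has_value_at source (x_fn / y * (n / d)) Infinity
        (0 * (to_ac (lead_coeff N) / to_ac (lead_coeff D)))"
      by (intro has_value_at_mult[OF source] has_value_at_divide[OF source]
          has_value_at_Infinity n d) simp
    ultimately show "has_value_at source (1 / y * X_fn) Infinity (?k * 0)" by simp
    have "1 / y * Y_fn = m / d\<^sup>2"
      by (simp add: Y_fn_def m_def d_def degree_M power_divide mult.commute flip: power_mult)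
    moreover have "has_value_at source (m / d\<^sup>2) Infinity ?k"
      by (intro has_value_at_divide[OF source] has_value_at_power[OF source] m d) simp
    ultimately show "has_value_at source (1 / y * Y_fn) Infinity (?k * 1)" by simp
    show "has_value_at source (1 / y) Infinity (?k * 0)"
      using has_value_at_Infinity(2) by simp
  qed (auto intro: function_field_intros)
qed

lemma morphism_\<phi>: "morphism source target \<phi>"
  unfolding morphism_def
proof (intro conjI allI impI rational_map_\<phi>)
  fix Q assume source: "on_curve (map_curve to_ac source) Q"
  consider (Infinity) "Q = Infinity"
    | (pole) z w where "Q = Affine z w" "eval_poly to_ac D z = 0"
    | (affine) z w where "Q = Affine z w" "eval_poly to_ac D z \<noteq> 0"
    by (cases Q) auto
  thus "\<exists>P. on_curve (map_curve to_ac target) P \<and> maps_to source \<phi> Q P"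
  proof cases
    case Infinity
    thus ?thesis using maps_to_Infinity by (intro exI[of _ Infinity]) auto
  next
    case pole
    thus ?thesis using maps_to_pole source by (intro exI[of _ Infinity]) auto
  next
    case affine
    thus ?thesis
      using formula_on_target[OF to_ac.comm_ring_hom_axioms] maps_to_affine source by blast
  qed
qed

lemma \<phi>_not_constant: "\<phi> \<notin> range (map_point const_fn)"
proof
  assume "\<phi> \<in> range (map_point const_fn)"
  then obtain P where "Affine X_fn Y_fn = map_point const_fn P"
    by (auto simp: \<phi>_def)
  then obtain k where "X_fn = const_fn k"
    by (cases P) auto
  hence "poly_fn N = poly_fn (smult k D)"
    by (simp add: X_fn_def divide_eq_eq)
  hence "N = smult k D"
    by (simp only: poly_fn_inject)
  thus False
    using degree_N degree_smult_le[of k D] by simp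
qed

theorem isogeny_\<phi>: "isogeny source target \<phi>"
  unfolding isogeny_def using morphism_\<phi> \<phi>_not_constant maps_to_Infinity by blast

end

section \<open>The degree of the isogeny\<close>

definition rational_functions_in :: "'k::field ambient \<Rightarrow> 'k ambient set" where
  "rational_functions_in u =
     {eval_poly const_fn p u / eval_poly const_fn q u | p q. eval_poly const_fn q u \<noteq> 0}"

lemma rational_functions_inI:
  "eval_poly const_fn q u \<noteq> 0 \<Longrightarrow> w = eval_poly const_fn p u / eval_poly const_fn q u \<Longrightarrow>
    w \<in> rational_functions_in u"
  unfolding rational_functions_in_def by blast

lemma rational_functions_inE:
  assumes "w \<in> rational_functions_in u"
  obtains p q where "eval_poly const_fn q u \<noteq> 0"
    and "w = eval_poly const_fn p u / eval_poly const_fn q u"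
  using assms unfolding rational_functions_in_def by blast

lemma eval_poly_in_rational_functions: "eval_poly const_fn p u \<in> rational_functions_in u"
  by (rule rational_functions_inI[of 1 _ _ p]) simp_all

lemma rational_functions_in_generators:
  "const_fn k \<in> rational_functions_in u" "u \<in> rational_functions_in u"
  using eval_poly_in_rational_functions[of "[:k:]" u]
    eval_poly_in_rational_functions[of "[:0, 1:]" u]
  by simp_all

lemma subfield_rational_functions_in: "subfield (rational_functions_in u) ring_of_type_algebra"
proof (rule subfield_type_algebraI)
  show "1 \<in> rational_functions_in u"
    using eval_poly_in_rational_functions[of 1 u] by simp
next
  fix v w assume "v \<in> rational_functions_in u" "w \<in> rational_functions_in u"
  then obtain p q p' q'
    where denominators: "eval_poly const_fn q u \<noteq> 0" "eval_poly const_fn q' u \<noteq> 0"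
    and vw: "v = eval_poly const_fn p u / eval_poly const_fn q u"
      "w = eval_poly const_fn p' u / eval_poly const_fn q' u"
    by (elim rational_functions_inE)
  show "v + w \<in> rational_functions_in u"
    by (rule rational_functions_inI[of "q * q'" _ _ "p * q' + p' * q"])
      (simp_all add: denominators vw add_frac_eq)
  show "v * w \<in> rational_functions_in u"
    by (rule rational_functions_inI[of "q * q'" _ _ "p * p'"]) (simp_all add: denominators vw)
next
  fix w assume "w \<in> rational_functions_in u"
  then obtain p q where q: "eval_poly const_fn q u \<noteq> 0"
    and w: "w = eval_poly const_fn p u / eval_poly const_fn q u"
    by (rule rational_functions_inE)
  show "- w \<in> rational_functions_in u"
    by (rule rational_functions_inI[of q _ _ "- p"]) (simp_all add: q w)
  show "inverse w \<in> rational_functions_in u"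
  proof (cases "w = 0")
    case True
    thus ?thesis using eval_poly_in_rational_functions[of 0 u] by simp
  next
    case False
    thus ?thesis by (intro rational_functions_inI[of p _ _ q]) (auto simp: w)
  qed
qed

lemma rational_functions_in_subset:
  assumes S: "subfield S ring_of_type_algebra" and "range const_fn \<subseteq> S" "u \<in> S"
  shows "rational_functions_in u \<subseteq> S"
proof -
  have "eval_poly const_fn p u \<in> S" for p
    using subfield_type_algebraD[OF S] assms by (intro const_fn.eval_poly_closed) auto
  thus ?thesis
    using subfield_type_algebraD(8)[OF S] by (auto elim!: rational_functions_inE)
qed

lemma y_fn_notin_rational_functions: "y_fn E \<notin> rational_functions_in x_fn"
proof
  assume "y_fn E \<in> rational_functions_in x_fn"
  then obtain p q where "poly_fn q \<noteq> 0" "y_fn E = poly_fn p / poly_fn q"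
    by (rule rational_functions_inE)
  hence "poly_fn (- p) + poly_fn q * y_fn E = 0" "q \<noteq> 0" by auto
  thus False using y_fn_independent(2) by blast
qed

lemma simple_extension_quadratic:
  fixes F :: "'a::field set"
  assumes F: "subfield F ring_of_type_algebra" and "w\<^sup>2 \<in> F"
    and "z \<in> ring.simple_extension ring_of_type_algebra F w"
  obtains u v where "u \<in> F" "v \<in> F" "z = u + v * w"
proof -
  interpret field "ring_of_type_algebra :: 'a ring" by rule
  note closed = subfield_type_algebraD[OF F]
  from assms(3) have "\<exists>u\<in>F. \<exists>v\<in>F. z = u + v * w"
  proof induction
    case zero
    show ?case using closed(1) by (intro bexI[of _ 0]) simp_all
  next
    case (lin s k)
    then obtain u v where "u \<in> F" "v \<in> F" "s = u + v * w" by blast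
    moreover from this have "s * w + k = (v * w\<^sup>2 + k) + u * w"
      by (simp add: algebra_simps power2_eq_square)
    ultimately show ?case
      using closed(3,4) \<open>k \<in> F\<close> \<open>w\<^sup>2 \<in> F\<close> by (intro bexI[of _ u] bexI[of _ "v * w\<^sup>2 + k"]) simp_all
  qed
  thus thesis using that by blast
qed

lemma generate_field_quadratic:
  fixes X_fn Y_fn :: "'k::field ambient"
  assumes "Y_fn\<^sup>2 \<in> rational_functions_in X_fn" and "z \<in> pullback_field (Affine X_fn Y_fn)"
  obtains u v where "u \<in> rational_functions_in X_fn" "v \<in> rational_functions_in X_fn"
    and "z = u + v * Y_fn"
proof -
  interpret field "ring_of_type_algebra :: 'k ambient ring" by rule
  let ?F = "rational_functions_in X_fn"
  note F = subfield_rational_functions_in[of X_fn]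
  have "subfield (simple_extension ?F Y_fn) ring_of_type_algebra"
  proof (rule subfield_simple_extension[OF F])
    show "set (coeffs [:- Y_fn\<^sup>2, 0, 1:]) \<subseteq> ?F"
      using subfield_type_algebraD[OF F] assms(1) by (auto simp: cCons_def)
    show "poly [:- Y_fn\<^sup>2, 0, 1:] Y_fn = 0"
      by (simp add: power2_eq_square)
  qed simp
  moreover have "?F \<subseteq> simple_extension ?F Y_fn"
    by (rule simple_extension_incl) auto
  moreover have "Y_fn \<in> simple_extension ?F Y_fn"
    by (rule simple_extension_mem[OF subfieldE(1)[OF F]]) auto
  ultimately have "pullback_field (Affine X_fn Y_fn) \<subseteq> simple_extension ?F Y_fn"
    using rational_functions_in_generators by (intro generate_field_subset) auto
  thus thesis
    using simple_extension_quadratic[OF F assms(1)] assms(2) that by blast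
qed

definition homogenize :: "'a::comm_ring_1 poly \<Rightarrow> 'a poly \<Rightarrow> 'a poly \<Rightarrow> 'a poly" where
  "homogenize N D p = (\<Sum>i\<le>degree p. smult (coeff p i) (N ^ i * D ^ (degree p - i)))"

lemma homogenize_eq_top_plus_rest:
  "homogenize N D p = smult (lead_coeff p) (N ^ degree p) +
    (\<Sum>i<degree p. smult (coeff p i) (N ^ i * D ^ (degree p - i)))"
  unfolding homogenize_def by (simp add: lessThan_Suc_atMost[symmetric] add.commute)

lemma degree_homogenize:
  fixes N D p :: "'a::field poly"
  assumes "degree D < degree N"
  shows "degree (homogenize N D p) = degree p * degree N"
proof (cases "degree p = 0")
  case True
  thus ?thesis by (simp add: homogenize_def)
next
  case False
  hence "p \<noteq> 0" "N \<noteq> 0" using assms by auto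
  hence top: "degree (smult (lead_coeff p) (N ^ degree p)) = degree p * degree N"
    by (simp add: degree_power_eq)
  have "degree (smult (coeff p i) (N ^ i * D ^ (degree p - i))) < degree p * degree N"
    if "i < degree p" for i
  proof -
    have "degree (smult (coeff p i) (N ^ i * D ^ (degree p - i))) \<le>
        degree (N ^ i * D ^ (degree p - i))"
      by (rule degree_smult_le)
    also have "\<dots> \<le> i * degree N + (degree p - i) * degree D"
      using degree_mult_le[of "N ^ i" "D ^ (degree p - i)"] degree_power_le[of N i]
        degree_power_le[of D "degree p - i"] by (simp add: mult.commute)
    also have "\<dots> < i * degree N + (degree p - i) * degree N"
      using assms that by simp
    also have "\<dots> = degree p * degree N"
      using that by (simp flip: distrib_right)
    finally show ?thesis .
  qed
  hence "degree (\<Sum>i<degree p. smult (coeff p i) (N ^ i * D ^ (degree p - i))) < degree p * degree N"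
    using False assms by (intro degree_sum_less) auto
  thus ?thesis
    unfolding homogenize_eq_top_plus_rest using top by (simp add: degree_add_eq_left)
qed

context comm_ring_hom begin

lemma eval_homogenize_at_root:
  assumes "eval_poly h D u = 0"
  shows "eval_poly h (homogenize N D p) u = h (lead_coeff p) * eval_poly h N u ^ degree p"
proof -
  interpret eval: comm_ring_hom "\<lambda>p. eval_poly h p u" by (rule comm_ring_hom_eval_poly)
  show ?thesis
    unfolding homogenize_eq_top_plus_rest using assms by (simp add: power_0_left)
qed

end

lemma eval_homogenize:
  fixes h :: "'a::comm_ring_1 \<Rightarrow> 'b::field"
  assumes "comm_ring_hom h" and D: "eval_poly h D u \<noteq> 0"
  shows "eval_poly h (homogenize N D p) u =
    eval_poly h D u ^ degree p * eval_poly h p (eval_poly h N u / eval_poly h D u)"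
proof -
  interpret comm_ring_hom h by fact
  interpret eval: comm_ring_hom "\<lambda>p. eval_poly h p u" by (rule comm_ring_hom_eval_poly)
  have "eval_poly h D u ^ degree p * eval_poly h p (eval_poly h N u / eval_poly h D u) =
      (\<Sum>i\<le>degree p. h (coeff p i) * (eval_poly h N u ^ i * eval_poly h D u ^ (degree p - i)))"
    unfolding eval_poly_altdef[of p] sum_distrib_left
    using D by (intro sum.cong) (auto simp: power_divide power_diff)
  thus ?thesis by (simp add: homogenize_def)
qed

context isogeny_formula
begin

text \<open>
  Comparing degrees in \<open>x q(X) = p(X)\<close> gives \<open>degree p = degree q + 1\<close>, so that \<open>p(X)/q(X)\<close> has a
  pole at each zero of \<open>D\<close>, whereas \<open>x\<close> has none.
\<close>

lemma x_fn_not_quotient: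
  assumes q: "eval_poly const_fn q X_fn \<noteq> 0"
  shows "x_fn * eval_poly const_fn q X_fn \<noteq> eval_poly const_fn p X_fn"
proof
  assume quotient: "x_fn * eval_poly const_fn q X_fn = eval_poly const_fn p X_fn"
  hence "p \<noteq> 0" "q \<noteq> 0" using q by auto
  let ?P = "homogenize N D p" and ?Q = "homogenize N D q"
  obtain z where z: "eval_poly to_ac D z = 0"
    using alg_closed_imp_poly_has_root[of "map_poly to_ac D"] degree_D
    by (auto simp: degree_map_poly eval_poly_def)
  have P_at_z: "eval_poly to_ac ?P z \<noteq> 0" and "eval_poly to_ac ?Q z \<noteq> 0"
    using \<open>p \<noteq> 0\<close> \<open>q \<noteq> 0\<close> no_common_root[OF z]
    by (simp_all add: to_ac.eval_homogenize_at_root[OF z])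
  hence "?P \<noteq> 0" "?Q \<noteq> 0" by auto
  have "poly_fn (homogenize N D r) = poly_fn D ^ degree r * eval_poly const_fn r X_fn" for r
    unfolding X_fn_def by (rule eval_homogenize[OF const_fn.comm_ring_hom_axioms]) simp
  hence "poly_fn ([:0, 1:] * ?Q * D ^ degree p) = poly_fn (?P * D ^ degree q)"
    by (simp flip: quotient)
  hence homogeneous: "[:0, 1:] * ?Q * D ^ degree p = ?P * D ^ degree q"
    by (simp only: poly_fn_inject)
  have "degree ([:0, 1:] * ?Q * D ^ degree p) =
      1 + degree q * (degree D + 1) + degree p * degree D"
    using \<open>?Q \<noteq> 0\<close> by (simp add: degree_mult_eq degree_power_eq degree_homogenize degree_N)
  moreover have "degree (?P * D ^ degree q) = degree p * (degree D + 1) + degree q * degree D"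
    using \<open>?P \<noteq> 0\<close> by (simp add: degree_mult_eq degree_power_eq degree_homogenize degree_N)
  ultimately have "degree p = Suc (degree q)"
    unfolding homogeneous by simp
  hence "[:0, 1:] * ?Q * D * D ^ degree q = ?P * D ^ degree q"
    using homogeneous by (simp add: mult.assoc)
  hence "?P = [:0, 1:] * ?Q * D"
    by (simp only: mult_right_cancel[OF power_not_zero[OF polys_neq_0(1)]])
  thus False
    using P_at_z z by simp
qed

lemma x_fn_notin_rational_functions_in_X_fn: "x_fn \<notin> rational_functions_in X_fn"
proof
  assume "x_fn \<in> rational_functions_in X_fn"
  then obtain p q where "eval_poly const_fn q X_fn \<noteq> 0"
    and "x_fn = eval_poly const_fn p X_fn / eval_poly const_fn q X_fn"
    by (rule rational_functions_inE)
  thus False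
    using x_fn_not_quotient[of q p] by (simp add: eq_divide_eq)
qed

lemma y_eq: "y = Y_fn * (poly_fn D)\<^sup>2 / poly_fn M"
  by (simp add: Y_fn_def)

lemma pullback_field_generators:
  "const_fn k \<in> pullback_field \<phi>" "X_fn \<in> pullback_field \<phi>" "Y_fn \<in> pullback_field \<phi>"
  by (auto simp: \<phi>_def intro: generate_field.incl)

lemma pullback_field_subset: "pullback_field \<phi> \<subseteq> function_field source"
  using X_fn_Y_fn_in_function_field
  by (intro generate_field_subset subfield_function_field)
    (auto simp: \<phi>_def intro: function_field_intros)

lemma x_fn_notin_pullback_field: "x_fn \<notin> pullback_field \<phi>"
proof
  let ?F = "rational_functions_in X_fn" and ?Kx = "rational_functions_in x_fn"
  note closed = subfield_type_algebraD[OF subfield_rational_functions_in[of x_fn]]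
  have "Y_fn\<^sup>2 \<in> ?F"
    using \<phi>_on_target eval_poly_in_rational_functions
    unfolding \<phi>_def on_curve_map_short_curve_iff[OF const_fn.comm_ring_hom_axioms] by metis
  moreover assume "x_fn \<in> pullback_field \<phi>"
  ultimately obtain u v where uv: "u \<in> ?F" "v \<in> ?F" "x_fn = u + v * Y_fn"
    unfolding \<phi>_def by (rule generate_field_quadratic)
  hence "v \<noteq> 0"
    using x_fn_notin_rational_functions_in_X_fn by auto
  have "X_fn \<in> ?Kx"
    unfolding X_fn_def by (intro closed eval_poly_in_rational_functions)
  hence "?F \<subseteq> ?Kx"
    using rational_functions_in_generators
    by (intro rational_functions_in_subset subfield_rational_functions_in) auto
  moreover have "Y_fn = (x_fn - u) / v"
    using \<open>v \<noteq> 0\<close> by (subst uv(3)) simp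
  ultimately have "Y_fn \<in> ?Kx"
    using uv(1,2) by (auto intro!: closed rational_functions_in_generators)
  hence "y \<in> ?Kx"
    unfolding y_eq by (intro closed eval_poly_in_rational_functions)
  thus False
    using y_fn_notin_rational_functions by blast
qed

lemma finite_dimension_over_pullback_field:
  "ring.finite_dimension ring_of_type_algebra (pullback_field \<phi>) (function_field source)"
proof (rule finite_dimension_if_simple)
  note closed = subfield_type_algebraD[OF subfield_generate_field]
  define q where "q = map_poly const_fn N - smult X_fn (map_poly const_fn D)"
  have "coeff q (degree N) = const_fn (lead_coeff N)"
    using degree_N by (simp add: q_def coeff_map_poly coeff_eq_0)
  thus "q \<noteq> 0" by auto
  have "coeff q i \<in> pullback_field \<phi>" for i
    using pullback_field_generators by (auto simp: q_def coeff_map_poly intro!: closed)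
  thus "set (coeffs q) \<subseteq> pullback_field \<phi>"
    by (auto simp: coeffs_def)
  show "poly q x_fn = 0"
    by (simp add: q_def X_fn_def flip: eval_poly_def)
next
  fix S :: "'k ambient set"
  assume S: "subfield S ring_of_type_algebra" "pullback_field \<phi> \<subseteq> S" "x_fn \<in> S"
  note closed = subfield_type_algebraD[OF S(1)]
  have poly_fn: "poly_fn p \<in> S" for p
    using closed S pullback_field_generators by (intro const_fn.eval_poly_closed) auto
  have "y \<in> S"
    unfolding y_eq using S(2) pullback_field_generators by (intro closed poly_fn) auto
  thus "function_field source \<subseteq> S"
    unfolding function_field_def using S pullback_field_generators
    by (intro generate_field_subset) auto
qed (rule subfield_generate_field subfield_function_field pullback_field_subset)+

theorem isogeny_degree_gt_1: "isogeny_degree source \<phi> > 1"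
  unfolding isogeny_degree_def
proof (rule extension_degree_gt_1)
  show "pullback_field \<phi> \<subset> function_field source"
    using pullback_field_subset x_fn_notin_pullback_field function_field_generators(2) by blast
qed (rule subfield_generate_field subfield_function_field finite_dimension_over_pullback_field)+

theorem K_magnified_target:
  assumes "elliptic_curve source" "on_curve source (Affine z w)" "poly D z \<noteq> 0"
  shows "K_magnified target (Affine (poly N z / poly D z) (w * poly M z / (poly D z)\<^sup>2))"
proof -
  have "on_curve (map_curve to_ac source) (map_point to_ac (Affine z w))"
    using assms(2) by (rule on_curve_map[OF to_ac.comm_ring_hom_axioms])
  hence "maps_to source \<phi> (map_point to_ac (Affine z w))
      (map_point to_ac (Affine (poly N z / poly D z) (w * poly M z / (poly D z)\<^sup>2)))"
    using maps_to_affine[of "to_ac z" "to_ac w"] assms(3) by (simp add: eval_poly_to_ac)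
  thus ?thesis
    unfolding K_magnified_def using assms isogeny_\<phi> isogeny_degree_gt_1 by blast
qed

end

section \<open>Duplication and isogenies of degree two\<close>

lemma discriminant_map_curve:
  assumes "comm_ring_hom h"
  shows "discriminant (map_curve h E) = h (discriminant E)"
proof -
  interpret comm_ring_hom h by fact
  show ?thesis by (cases E) (simp add: Let_def)
qed

lemma elliptic_curve_map_to_ac: "elliptic_curve E \<Longrightarrow> elliptic_curve (map_curve to_ac E)"
  by (simp add: elliptic_curve_def discriminant_map_curve[OF to_ac.comm_ring_hom_axioms])

lemma discriminant_short_curve:
  fixes a b c :: "'a::field"
  shows "discriminant (short_curve a b c) =
    16 * (a\<^sup>2 * b\<^sup>2 - 4 * b ^ 3 - 4 * a ^ 3 * c - 27 * c\<^sup>2 + 18 * a * b * c)"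
  by (simp add: algebra_simps eval_nat_numeral)

lemma discriminant_eq_0_if_double_root:
  fixes z :: "'a::field"
  assumes "poly (cubic a b c) z = 0" "3 * z\<^sup>2 + 2 * a * z + b = 0"
  shows "discriminant (short_curve a b c) = 0"
proof -
  have "z ^ 3 + a * z\<^sup>2 + b * z + c = 0"
    using assms(1) by (simp add: algebra_simps power2_eq_square power3_eq_cube)
  hence "a\<^sup>2 * b\<^sup>2 - 4 * b ^ 3 - 4 * a ^ 3 * c - 27 * c\<^sup>2 + 18 * a * b * c = 0"
    using assms(2) by Groebner_Basis.algebra
  thus ?thesis by (simp only: discriminant_short_curve mult_zero_right)
qed

definition duplication_numerator :: "'a::comm_ring_1 \<Rightarrow> 'a \<Rightarrow> 'a \<Rightarrow> 'a poly" where
  "duplication_numerator a b c = [:b\<^sup>2 - 4 * a * c, - 8 * c, - 2 * b, 0, 1:]"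

definition duplication_cofactor :: "'a::comm_ring_1 \<Rightarrow> 'a \<Rightarrow> 'a \<Rightarrow> 'a poly" where
  "duplication_cofactor a b c =
     [:2 * (4 * a * b * c - b ^ 3 - 8 * c\<^sup>2), 2 * (8 * a\<^sup>2 * c - 2 * a * b\<^sup>2 - 4 * b * c),
       2 * (20 * a * c - 5 * b\<^sup>2), 40 * c, 10 * b, 4 * a, 2:]"

lemma duplication_identity:
  fixes a b c :: "'a::field"
  defines "N \<equiv> duplication_numerator a b c" and "D \<equiv> smult 4 (cubic a b c)"
  shows "(duplication_cofactor a b c)\<^sup>2 =
    4 * (N ^ 3 + [:a:] * N\<^sup>2 * D + [:b:] * N * D\<^sup>2 + [:c:] * D ^ 3)"
proof -
  define x where "x = [:0, 1::'a:]"
  note poly_simps = x_def numeral_poly one_pCons algebra_simps eval_nat_numeral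
  have N: "N = x ^ 4 - 2 * [:b:] * x\<^sup>2 - 8 * [:c:] * x + [:b:]\<^sup>2 - 4 * [:a:] * [:c:]"
    by (simp add: N_def duplication_numerator_def poly_simps)
  have D: "D = 4 * (x ^ 3 + [:a:] * x\<^sup>2 + [:b:] * x + [:c:])"
    by (simp add: D_def poly_simps)
  have M: "duplication_cofactor a b c =
      2 * (x ^ 6 + 2 * [:a:] * x ^ 5 + 5 * [:b:] * x ^ 4 + 20 * [:c:] * x ^ 3
      + (20 * [:a:] * [:c:] - 5 * [:b:]\<^sup>2) * x\<^sup>2
      + (8 * [:a:]\<^sup>2 * [:c:] - 2 * [:a:] * [:b:]\<^sup>2 - 4 * [:b:] * [:c:]) * x
      + (4 * [:a:] * [:b:] * [:c:] - [:b:] ^ 3 - 8 * [:c:]\<^sup>2))"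
    by (simp add: duplication_cofactor_def poly_simps)
  show ?thesis
    unfolding M N D by Groebner_Basis.algebra
qed

lemma duplication_no_common_root:
  fixes z :: "'a::field"
  assumes "elliptic_curve (short_curve a b c)" and root: "poly (cubic a b c) z = 0"
  shows "poly (duplication_numerator a b c) z \<noteq> 0"
proof
  assume "poly (duplication_numerator a b c) z = 0"
  hence "z ^ 4 - 2 * b * z\<^sup>2 - 8 * c * z + b\<^sup>2 - 4 * a * c = 0"
    by (simp add: duplication_numerator_def algebra_simps eval_nat_numeral)
  moreover have "z ^ 3 + a * z\<^sup>2 + b * z + c = 0"
    using root by (simp add: algebra_simps power2_eq_square power3_eq_cube)
  ultimately have "(3 * z\<^sup>2 + 2 * a * z + b)\<^sup>2 = 0"
    by Groebner_Basis.algebra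
  hence "discriminant (short_curve a b c) = 0"
    by (intro discriminant_eq_0_if_double_root[OF root]) simp
  thus False using assms(1) by (simp add: elliptic_curve_def)
qed

lemma powers_of_two_neq_0:
  assumes "(2 :: 'a::field) \<noteq> 0"
  shows "(4 :: 'a) \<noteq> 0" "(8 :: 'a) \<noteq> 0" "(16 :: 'a) \<noteq> 0" "(64 :: 'a) \<noteq> 0"
  using power_not_zero[OF assms, of 2] power_not_zero[OF assms, of 3] power_not_zero[OF assms, of 4]
    power_not_zero[OF assms, of 6] by simp_all

lemma isogeny_formula_duplication:
  fixes a b c :: "'k::field"
  assumes two: "(2::'k) \<noteq> 0" and elliptic: "elliptic_curve (short_curve a b c)"
  shows "isogeny_formula a b c a b c (duplication_numerator a b c) (smult 4 (cubic a b c))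
    (duplication_cofactor a b c) [:1 / 4:]"
proof
  let ?N = "duplication_numerator a b c" and ?D = "smult 4 (cubic a b c)"
  note four = powers_of_two_neq_0(1)[OF two]
  show "cubic a b c = ?D * [:1 / 4:]"
    using four by simp
  have "4 * [:1 / 4 :: 'k:] = 1"
    using four by (simp add: one_pCons numeral_poly)
  hence "(4 * S) * [:1 / 4:] = S" for S :: "'k poly"
    by (simp only: mult.commute[of 4 S] mult.assoc mult_1_right)
  thus "(duplication_cofactor a b c)\<^sup>2 * [:1 / 4:] =
      ?N ^ 3 + [:a:] * ?N\<^sup>2 * ?D + [:b:] * ?N * ?D\<^sup>2 + [:c:] * ?D ^ 3"
    unfolding duplication_identity .
  show "degree ?D > 0" "degree ?N = degree ?D + 1"
    "degree (duplication_cofactor a b c) = 2 * degree ?D"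
    using two four by (simp_all add: duplication_numerator_def duplication_cofactor_def)
  fix z assume "eval_poly to_ac ?D z = 0"
  hence "to_ac 4 * eval_poly to_ac (cubic a b c) z = 0"
    by (simp only: to_ac.eval_poly_smult)
  hence "poly (cubic (to_ac a) (to_ac b) (to_ac c)) z = 0"
    using four unfolding mult_eq_0_iff to_ac_eq_0_iff by simp
  moreover have "elliptic_curve (short_curve (to_ac a) (to_ac b) (to_ac c))"
    using elliptic_curve_map_to_ac[OF elliptic] by simp
  ultimately have "poly (duplication_numerator (to_ac a) (to_ac b) (to_ac c)) z \<noteq> 0"
    by (rule duplication_no_common_root[rotated])
  thus "eval_poly to_ac ?N z \<noteq> 0"
    by (simp add: duplication_numerator_def)
qed

lemma duplication_values:
  fixes z w m :: "'a::field"
  assumes w: "w\<^sup>2 = poly (cubic a b c) z" and m: "2 * w * m = 3 * z\<^sup>2 + 2 * a * z + b"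
  defines "u \<equiv> m\<^sup>2 - a - 2 * z"
  shows "poly (duplication_numerator a b c) z = u * (4 * w\<^sup>2)"
    and "w * poly (duplication_cofactor a b c) z = - (w + m * (u - z)) * (4 * w\<^sup>2)\<^sup>2"
proof -
  have b: "b = 2 * w * m - 3 * z\<^sup>2 - 2 * a * z"
    using m by simp
  have c: "c = w\<^sup>2 - z ^ 3 - a * z\<^sup>2 - b * z"
    using w by (simp add: algebra_simps power2_eq_square power3_eq_cube)
  show "poly (duplication_numerator a b c) z = u * (4 * w\<^sup>2)"
    unfolding duplication_numerator_def u_def poly_pCons poly_0 c b by Groebner_Basis.algebra
  show "w * poly (duplication_cofactor a b c) z = - (w + m * (u - z)) * (4 * w\<^sup>2)\<^sup>2"
    unfolding duplication_cofactor_def u_def poly_pCons poly_0 c b by Groebner_Basis.algebra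
qed

theorem K_magnified_double:
  fixes a b c :: "'k::field"
  defines "E \<equiv> short_curve a b c"
  assumes two: "(2::'k) \<noteq> 0" and "elliptic_curve E" "on_curve E R" "point_add E R R \<noteq> Infinity"
  shows "K_magnified E (point_add E R R)"
proof -
  obtain z w where R: "R = Affine z w"
    using assms(5) by (cases R) auto
  have w: "w\<^sup>2 = poly (cubic a b c) z"
    using assms(4) unfolding E_def R on_short_curve_iff .
  have "2 * w \<noteq> 0"
    using assms(5) unfolding E_def R point_double_eq_Infinity_iff by simp
  hence D: "4 * w\<^sup>2 \<noteq> 0"
    using powers_of_two_neq_0(1)[OF two] by simp
  define m where "m = (3 * z\<^sup>2 + 2 * a * z + b) / (2 * w)"
  define u where "u = m\<^sup>2 - a - 2 * z"
  have m: "2 * w * m = 3 * z\<^sup>2 + 2 * a * z + b"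
    using \<open>2 * w \<noteq> 0\<close> by (simp add: m_def)
  interpret isogeny_formula a b c a b c "duplication_numerator a b c" "smult 4 (cubic a b c)"
    "duplication_cofactor a b c" "[:1 / 4:]"
    using assms(2,3) unfolding E_def by (rule isogeny_formula_duplication)
  have denominator: "poly (smult 4 (cubic a b c)) z = 4 * w\<^sup>2"
    unfolding poly_smult w ..
  have "K_magnified E (Affine (poly (duplication_numerator a b c) z / (4 * w\<^sup>2))
      (w * poly (duplication_cofactor a b c) z / (4 * w\<^sup>2)\<^sup>2))"
    using K_magnified_target[of z w, unfolded denominator] assms(3,4) D unfolding E_def R by blast
  moreover have "poly (duplication_numerator a b c) z / (4 * w\<^sup>2) = u"
    unfolding duplication_values(1)[OF w m] u_def using D by (rule nonzero_mult_div_cancel_right)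
  moreover have "w * poly (duplication_cofactor a b c) z / (4 * w\<^sup>2)\<^sup>2 = - (w + m * (u - z))"
    unfolding duplication_values(2)[OF w m] u_def
    using D by (intro nonzero_mult_div_cancel_right power_not_zero)
  moreover have "point_add E R R = Affine u (- (w + m * (u - z)))"
    unfolding E_def R u_def
    using point_double_slope[of w 0 z 0 m a b _ c, OF _ _ refl] \<open>2 * w \<noteq> 0\<close> m
    by (simp add: mult.commute del: point_add.simps)
  ultimately show ?thesis by (simp only:)
qed

lemma isogeny_formula_degree_2:
  fixes a b :: "'k::field"
  assumes two: "(2::'k) \<noteq> 0" and dual: "a\<^sup>2 - 4 * b \<noteq> 0"
  defines "d \<equiv> a\<^sup>2 - 4 * b"
  defines "N \<equiv> [:d, - 2 * a, 1:]"
  shows "isogeny_formula (- 2 * a) d 0 a b 0 N [:0, 4:] [:2 * d, 0, - 2:] (smult (1 / 4) N)"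
proof
  note four = powers_of_two_neq_0(1)[OF two]
  let ?D = "[:0, 4 :: 'k:]" and ?M = "[:2 * d, 0, - 2:]"
  show "cubic (- 2 * a) d 0 = ?D * smult (1 / 4) N"
    using four by (simp add: N_def)
  have G: "4 * smult (1 / 4) N = N"
    using four by (simp add: numeral_poly)
  have "?M\<^sup>2 = 4 * (N\<^sup>2 + [:a:] * N * ?D + [:b:] * ?D\<^sup>2)"
    by (simp add: N_def d_def numeral_poly one_pCons algebra_simps eval_nat_numeral)
  hence "?M\<^sup>2 * smult (1 / 4) N = (4 * smult (1 / 4) N) * (N\<^sup>2 + [:a:] * N * ?D + [:b:] * ?D\<^sup>2)"
    by (simp only: ac_simps)
  also have "\<dots> = N ^ 3 + [:a:] * N\<^sup>2 * ?D + [:b:] * N * ?D\<^sup>2 + [:0:] * ?D ^ 3"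
    unfolding G by (simp only: distrib_left power2_eq_square power3_eq_cube ac_simps pCons_0_0
        mult_zero_left add_0_left)
  finally show "?M\<^sup>2 * smult (1 / 4) N =
      N ^ 3 + [:a:] * N\<^sup>2 * ?D + [:b:] * N * ?D\<^sup>2 + [:0:] * ?D ^ 3" .
  show "degree ?D > 0" "degree N = degree ?D + 1" "degree ?M = 2 * degree ?D"
    using two four by (simp_all add: N_def)
  fix z assume "eval_poly to_ac ?D z = 0"
  hence "z * to_ac 4 = 0" by simp
  hence "z = 0" using four unfolding mult_eq_0_iff to_ac_eq_0_iff by simp
  thus "eval_poly to_ac N z \<noteq> 0"
    using dual by (simp add: N_def d_def del: to_ac.hom_diff to_ac_diff)
qed

lemma elliptic_curve_short_0_iff:
  fixes a b :: "'a::field"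
  assumes two: "(2::'a) \<noteq> 0"
  shows "elliptic_curve (short_curve a b 0) \<longleftrightarrow> b \<noteq> 0 \<and> a\<^sup>2 - 4 * b \<noteq> 0"
proof -
  have "discriminant (short_curve a b 0) = 16 * (b\<^sup>2 * (a\<^sup>2 - 4 * b))"
    unfolding discriminant_short_curve by (simp add: algebra_simps eval_nat_numeral)
  thus ?thesis
    using powers_of_two_neq_0(3)[OF two]
    unfolding elliptic_curve_def by (simp only: mult_eq_0_iff power_eq_0_iff) simp
qed

lemma degree_2_preimage:
  fixes a b \<rho> v :: "'a::field"
  assumes "\<rho> \<noteq> 0" and v: "v\<^sup>2 = poly (cubic a b 0) (\<rho>\<^sup>2)"
  defines "d \<equiv> a\<^sup>2 - 4 * b"
  obtains z where "(2 * \<rho> * z)\<^sup>2 = poly (cubic (- 2 * a) d 0) z"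
    and "poly [:d, - 2 * a, 1:] z = \<rho>\<^sup>2 * (4 * z)"
    and "2 * \<rho> * z * poly [:2 * d, 0, - 2:] z = v * (4 * z)\<^sup>2"
proof
  \<comment> \<open>The preimage \<open>(z, y)\<close> is the solution of \<open>y = 2 \<rho> z\<close>, \<open>\<rho> (d - z\<^sup>2) = 4 z v\<close>.\<close>
  define z where "z = 2 * \<rho>\<^sup>2 + a - 2 * v / \<rho>"
  have z: "z * \<rho> = 2 * \<rho> ^ 3 + a * \<rho> - 2 * v"
    using \<open>\<rho> \<noteq> 0\<close>
    by (simp add: z_def left_diff_distrib distrib_right power2_eq_square power3_eq_cube)
  have "v\<^sup>2 = \<rho> ^ 6 + a * \<rho> ^ 4 + b * \<rho>\<^sup>2"
    using v by (simp add: algebra_simps eval_nat_numeral)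
  hence "(z\<^sup>2 - 2 * a * z + d - \<rho>\<^sup>2 * (4 * z)) * \<rho>\<^sup>2 = 0"
    using z unfolding d_def by Groebner_Basis.algebra
  hence abscissa: "z\<^sup>2 - 2 * a * z + d = \<rho>\<^sup>2 * (4 * z)"
    using \<open>\<rho> \<noteq> 0\<close> by simp
  thus "poly [:d, - 2 * a, 1:] z = \<rho>\<^sup>2 * (4 * z)"
    by (simp add: algebra_simps power2_eq_square)
  have "(2 * \<rho> * z)\<^sup>2 = z * (\<rho>\<^sup>2 * (4 * z))"
    by (simp add: power2_eq_square)
  thus "(2 * \<rho> * z)\<^sup>2 = poly (cubic (- 2 * a) d 0) z"
    unfolding abscissa[symmetric] by (simp add: algebra_simps power2_eq_square)
  have ordinate: "\<rho> * (d - z\<^sup>2) = 4 * z * v"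
    using abscissa z by Groebner_Basis.algebra
  have "2 * \<rho> * z * poly [:2 * d, 0, - 2:] z = 4 * z * (\<rho> * (d - z\<^sup>2))"
    by (simp add: algebra_simps power2_eq_square)
  also have "\<dots> = v * (4 * z)\<^sup>2"
    unfolding ordinate by (simp add: power2_eq_square)
  finally show "2 * \<rho> * z * poly [:2 * d, 0, - 2:] z = v * (4 * z)\<^sup>2" .
qed

theorem K_magnified_if_abscissa_square:
  fixes a b \<rho> v :: "'k::field"
  defines "E \<equiv> short_curve a b 0"
  assumes two: "(2::'k) \<noteq> 0" and elliptic: "elliptic_curve E"
    and on_curve: "on_curve E (Affine (\<rho>\<^sup>2) v)" and "\<rho> \<noteq> 0"
  shows "K_magnified E (Affine (\<rho>\<^sup>2) v)"
proof -
  define d where "d = a\<^sup>2 - 4 * b"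
  define N where "N = [:d, - 2 * a, 1:]"
  have nonzero: "b \<noteq> 0" "d \<noteq> 0"
    using elliptic unfolding E_def elliptic_curve_short_0_iff[OF two] d_def by auto
  interpret isogeny_formula "- 2 * a" d 0 a b 0 N "[:0, 4:]" "[:2 * d, 0, - 2:]" "smult (1 / 4) N"
    unfolding N_def d_def by (rule isogeny_formula_degree_2[OF two nonzero(2)[unfolded d_def]])
  have "(- 2 * a)\<^sup>2 - 4 * d = 16 * b"
    by (simp add: d_def power2_eq_square)
  hence source: "elliptic_curve source"
    using nonzero powers_of_two_neq_0(3)[OF two]
    unfolding elliptic_curve_short_0_iff[OF two] by simp
  have "v\<^sup>2 = poly (cubic a b 0) (\<rho>\<^sup>2)"
    using on_curve unfolding E_def on_short_curve_iff .
  then obtain z where on_source: "(2 * \<rho> * z)\<^sup>2 = poly (cubic (- 2 * a) d 0) z"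
    and abscissa: "poly N z = \<rho>\<^sup>2 * (4 * z)"
    and ordinate: "2 * \<rho> * z * poly [:2 * d, 0, - 2:] z = v * (4 * z)\<^sup>2"
    unfolding N_def d_def by (rule degree_2_preimage[OF \<open>\<rho> \<noteq> 0\<close>])
  have "z \<noteq> 0"
    using abscissa nonzero by (auto simp: N_def)
  hence D: "4 * z \<noteq> 0"
    using powers_of_two_neq_0(1)[OF two] by simp
  have denominator: "poly [:0, 4:] z = 4 * z"
    by simp
  have "K_magnified E (Affine (poly N z / (4 * z))
      (2 * \<rho> * z * poly [:2 * d, 0, - 2:] z / (4 * z)\<^sup>2))"
    using K_magnified_target[OF source, of z, unfolded denominator on_short_curve_iff] on_source D
    unfolding E_def by blast
  thus ?thesis
    unfolding abscissa ordinate nonzero_mult_div_cancel_right[OF D]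
      nonzero_mult_div_cancel_right[OF power_not_zero[OF D]] .
qed

section \<open>Halving a point\<close>

text \<open>
  The point to be halved is \<open>(0, v)\<close> on \<open>y\<^sup>2 = x\<^sup>3 + a x\<^sup>2 + b x + v\<^sup>2\<close>. The tangent at a half
  passes through \<open>(0, -v)\<close>, and the roots of the quartic are the slopes of the tangents through
  this point.
\<close>

definition halving_quartic :: "'a::comm_ring_1 \<Rightarrow> 'a \<Rightarrow> 'a \<Rightarrow> 'a poly" where
  "halving_quartic a b v = [:a\<^sup>2 - 4 * b, - 8 * v, - 2 * a, 0, 1:]"

lemma eval_halving_quartic:
  assumes "comm_ring_hom h"
  shows "eval_poly h (halving_quartic a b v) m = poly (halving_quartic (h a) (h b) (h v)) m"
proof -
  interpret comm_ring_hom h by fact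
  show ?thesis by (simp add: halving_quartic_def)
qed

lemma halving_quartic_root_if_half:
  fixes a b c v z w :: "'a::field"
  assumes "point_add (short_curve a b c) (Affine z w) (Affine z w) = Affine 0 v"
  shows "poly (halving_quartic a b v) ((3 * z\<^sup>2 + 2 * a * z + b) / (2 * w)) = 0"
proof -
  define m where "m = (3 * z\<^sup>2 + 2 * a * z + b) / (2 * w)"
  have "2 * w \<noteq> 0"
    using assms point_double_eq_Infinity_iff[of 0 a 0 b c z w] by auto
  hence m: "2 * w * m = 3 * z\<^sup>2 + 2 * a * z + b"
    by (simp add: m_def)
  have "point_add (short_curve a b c) (Affine z w) (Affine z w) =
      Affine (m\<^sup>2 - a - 2 * z) (- (w + m * (m\<^sup>2 - a - 2 * z - z)))"
    using point_double_slope[of w 0 z 0 m a b _ c, OF _ _ refl] \<open>2 * w \<noteq> 0\<close> m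
    by (simp add: mult.commute del: point_add.simps)
  hence x: "m\<^sup>2 - a - 2 * z = 0" and y: "- (w + m * (m\<^sup>2 - a - 2 * z - z)) = v"
    using assms by (simp_all only: point.inject)
  have a: "a = m\<^sup>2 - 2 * z"
    using x by (simp add: algebra_simps)
  have w: "w = m * z - v"
    unfolding y[unfolded x, symmetric] by simp
  have b: "b = 2 * w * m - 3 * z\<^sup>2 - 2 * a * z"
    using m by simp
  have "poly (halving_quartic a b v) m = 0"
    unfolding halving_quartic_def b w a by (simp add: algebra_simps eval_nat_numeral)
  thus ?thesis by (simp only: m_def)
qed

lemma half_if_halving_quartic_root:
  fixes a b v m :: "'a::field"
  defines "E \<equiv> short_curve a b (v\<^sup>2)"
  assumes two: "(2::'a) \<noteq> 0" and elliptic: "elliptic_curve E"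
    and root: "poly (halving_quartic a b v) m = 0"
  obtains R where "on_curve E R" "point_add E R R = Affine 0 v"
proof -
  define z where "z = (m\<^sup>2 - a) / 2"
  define w where "w = m * z - v"
  have "2 * z = m\<^sup>2 - a"
    using two by (simp add: z_def)
  hence a: "a = m\<^sup>2 - 2 * z"
    by simp
  have "4 * b = 4 * (z\<^sup>2 - 2 * v * m)"
    using root unfolding halving_quartic_def a by (simp add: algebra_simps eval_nat_numeral)
  hence b: "b = z\<^sup>2 - 2 * v * m"
    by (simp only: mult_left_cancel[OF powers_of_two_neq_0(1)[OF two]])
  have cubic: "w\<^sup>2 = poly (cubic a b (v\<^sup>2)) z"
    unfolding w_def b a by (simp add: algebra_simps power2_eq_square)
  have slope: "m * (2 * w) = 3 * z\<^sup>2 + 2 * a * z + b"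
    unfolding w_def b a by (simp add: algebra_simps power2_eq_square)
  have "w \<noteq> 0"
  proof
    assume "w = 0"
    hence "discriminant E = 0"
      unfolding E_def using cubic slope by (intro discriminant_eq_0_if_double_root[of _ _ _ z]) auto
    thus False using elliptic by (simp add: elliptic_curve_def)
  qed
  moreover have "m\<^sup>2 - a - 2 * z = 0"
    unfolding a by simp
  ultimately have "point_add E (Affine z w) (Affine z w) = Affine 0 (- (w + m * (0 - z)))"
    using point_double_slope[of w 0 z 0 m a b 0 "v\<^sup>2"] two slope
    by (simp add: E_def del: point_add.simps)
  moreover have "on_curve E (Affine z w)"
    unfolding E_def on_short_curve_iff by (rule cubic)
  ultimately show thesis
    using that by (simp add: w_def)
qed

lemma degree_1_imp_root:
  fixes p :: "'a::field poly"
  assumes "degree p = 1"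
  shows "\<exists>k. poly p k = 0"
proof -
  obtain u v where "p = [:u, v:]" "v \<noteq> 0"
    using degree1_coeffs[OF assms] by metis
  thus ?thesis by (intro exI[of _ "- u / v"]) simp
qed

lemma reducible_quartic_cases:
  fixes q r :: "'a::field poly"
  assumes "degree (q * r) = 4" "degree q > 0" "degree r > 0"
  shows "(\<exists>k. poly (q * r) k = 0) \<or> degree q = 2 \<and> degree r = 2"
proof -
  have "degree q + degree r = 4"
    using assms by (subst degree_mult_eq[symmetric]) auto
  then consider "degree q = 1" | "degree r = 1" | "degree q = 2" "degree r = 2"
    using assms(2,3) by linarith
  thus ?thesis
    using degree_1_imp_root by cases fastforce+
qed

lemma depressed_quartic_factorization:
  fixes q r :: "'k::field poly"
  assumes "degree q = 2" "degree r = 2" "q * r = [:g0, g1, g2, 0, 1:]"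
  obtains s t p where "t + s - p\<^sup>2 = g2" "p * (t - s) = g1" "s * t = g0"
proof -
  obtain q0 q1 q2 where q: "q = [:q0, q1, q2:]"
    using degree2_coeffs[OF assms(1)] by metis
  obtain r0 r1 r2 where r: "r = [:r0, r1, r2:]"
    using degree2_coeffs[OF assms(2)] by metis
  have coeffs: "q0 * r0 = g0" "q0 * r1 + q1 * r0 = g1" "q0 * r2 + q1 * r1 + q2 * r0 = g2"
    "q1 * r2 + q2 * r1 = 0" "q2 * r2 = 1"
    using assms(3) by (auto simp: q r algebra_simps)
  have "r1 = r2 * (q1 * r2 + q2 * r1) - q1 * r2\<^sup>2"
    using coeffs(5) by (simp add: algebra_simps power2_eq_square)
  hence r1: "r1 = - (q1 * r2\<^sup>2)"
    by (simp add: coeffs(4))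
  show thesis
  proof
    show "q2 * r0 + r2 * q0 - (r2 * q1)\<^sup>2 = g2"
      unfolding coeffs(3)[symmetric] r1 by Groebner_Basis.algebra
    show "r2 * q1 * (q2 * r0 - r2 * q0) = g1"
      using coeffs(5) unfolding coeffs(2)[symmetric] r1 by Groebner_Basis.algebra
    have "(r2 * q0) * (q2 * r0) = (q2 * r2) * (q0 * r0)"
      by (simp only: ac_simps)
    thus "r2 * q0 * (q2 * r0) = g0"
      by (simp add: coeffs)
  qed
qed

text \<open>The resolvent cubic of the quartic is the cubic of the curve, evaluated at \<open>-x\<close>.\<close>

lemma resolvent_root_if_halving_quartic_factorization:
  fixes a b v :: "'k::field"
  assumes two: "(2::'k) \<noteq> 0" and "v \<noteq> 0"
    and "degree q = 2" "degree r = 2" "q * r = halving_quartic a b v"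
  obtains \<rho> where "\<rho> \<noteq> 0" "poly (cubic a b (v\<^sup>2)) (- \<rho>\<^sup>2) = 0"
proof -
  obtain s t p where factors: "t + s - p\<^sup>2 = - 2 * a" "p * (t - s) = - 8 * v" "s * t = a\<^sup>2 - 4 * b"
    using depressed_quartic_factorization[OF assms(3,4), of "a\<^sup>2 - 4 * b" "- 8 * v" "- 2 * a"]
      assms(5)
    unfolding halving_quartic_def by metis
  define \<rho> where "\<rho> = p / 2"
  have p: "p = 2 * \<rho>"
    using two by (simp add: \<rho>_def)
  have sum: "t + s = 4 * \<rho>\<^sup>2 - 2 * a"
    using factors(1) by (simp add: p algebra_simps power2_eq_square)
  have "64 * poly (cubic a b (v\<^sup>2)) (- \<rho>\<^sup>2) =
      (- 8 * v)\<^sup>2 - (2 * \<rho>)\<^sup>2 * ((4 * \<rho>\<^sup>2 - 2 * a)\<^sup>2 - 4 * (a\<^sup>2 - 4 * b))"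
    by (simp add: algebra_simps eval_nat_numeral)
  also have "\<dots> = (p * (t - s))\<^sup>2 - p\<^sup>2 * ((t + s)\<^sup>2 - 4 * (s * t))"
    unfolding factors(2,3) sum by (simp only: p)
  also have "\<dots> = 0"
    by Groebner_Basis.algebra
  finally have "poly (cubic a b (v\<^sup>2)) (- \<rho>\<^sup>2) = 0"
    using powers_of_two_neq_0(4)[OF two] by (simp only: mult_eq_0_iff simp_thms)
  moreover have "\<rho> \<noteq> 0"
    using factors(2) \<open>v \<noteq> 0\<close> powers_of_two_neq_0(2)[OF two] by (auto simp: p)
  ultimately show thesis using that by blast
qed

lemma K_magnified_change_iff:
  "K_magnified (change_curve r s t E) (change_point r s t P) \<longleftrightarrow> K_magnified E P"
  using K_magnified_change[of E P r s t]
    K_magnified_change[of "change_curve r s t E" "change_point r s t P" "- r" "- s" "r * s - t"]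
  by (auto simp: change_curve_inverse change_point_inverse)

lemma K_magnified_if_resolvent_root:
  fixes a b v \<rho> :: "'k::field"
  defines "E \<equiv> short_curve a b (v\<^sup>2)"
  assumes two: "(2::'k) \<noteq> 0" and "elliptic_curve E" and "\<rho> \<noteq> 0"
    and root: "poly (cubic a b (v\<^sup>2)) (- \<rho>\<^sup>2) = 0"
  shows "K_magnified E (Affine 0 v)"
proof -
  let ?A = "a - 3 * \<rho>\<^sup>2" and ?B = "b - 2 * a * \<rho>\<^sup>2 + 3 * \<rho> ^ 4"
  have curve: "change_curve (- \<rho>\<^sup>2) 0 0 E = short_curve ?A ?B 0"
    using root by (simp add: E_def algebra_simps eval_nat_numeral)
  have point: "change_point (- \<rho>\<^sup>2) 0 0 (Affine 0 v) = Affine (\<rho>\<^sup>2) v"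
    by simp
  have "on_curve E (Affine 0 v)"
    by (simp add: E_def)
  hence "on_curve (short_curve ?A ?B 0) (Affine (\<rho>\<^sup>2) v)"
    using on_curve_change[of E "Affine 0 v" "- \<rho>\<^sup>2" 0 0] unfolding curve point by blast
  moreover have "elliptic_curve (short_curve ?A ?B 0)"
    using \<open>elliptic_curve E\<close> unfolding curve[symmetric] elliptic_curve_change_curve .
  ultimately have "K_magnified (short_curve ?A ?B 0) (Affine (\<rho>\<^sup>2) v)"
    using K_magnified_if_abscissa_square[OF two] \<open>\<rho> \<noteq> 0\<close> by blast
  thus ?thesis
    unfolding curve[symmetric] point[symmetric] K_magnified_change_iff .
qed

lemma halving_quartic_root_if_magnified_by_doubling:
  fixes a b v :: "'k::field"
  assumes "magnified_by_doubling (short_curve a b c) (Affine 0 v)"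
  obtains L m where "finite_field_extension (range to_ac) L" "extension_degree (range to_ac) L < 4"
    and "m \<in> L" "eval_poly to_ac (halving_quartic a b v) m = 0"
proof -
  let ?E = "map_curve to_ac (short_curve a b c)"
  obtain L R where L: "finite_field_extension (range to_ac) L"
      "extension_degree (range to_ac) L < 4"
    and R: "R \<in> points_over ?E L" "point_add ?E R R = Affine 0 (to_ac v)"
    using assms unfolding magnified_by_doubling_def by auto
  obtain z w where zw: "R = Affine z w"
    using R(2) by (cases R) auto
  let ?m = "(3 * z\<^sup>2 + 2 * to_ac a * z + to_ac b) / (2 * w)"
  have "eval_poly to_ac (halving_quartic a b v) ?m = 0"
    unfolding eval_halving_quartic[OF to_ac.comm_ring_hom_axioms]
    using R(2) by (intro halving_quartic_root_if_half) (simp only: zw curve.map to_ac.hom_0)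
  moreover have "?m \<in> L"
  proof -
    have subfield: "subfield L ring_of_type_algebra" and "range to_ac \<subseteq> L"
      using L(1) by (auto simp: finite_field_extension_def)
    moreover have "numeral n \<in> L" for n
      using \<open>range to_ac \<subseteq> L\<close> to_ac.hom_numeral by (metis rangeI subsetD)
    moreover have "z \<in> L" "w \<in> L"
      using R(1) by (auto simp: points_over_def zw)
    ultimately show ?thesis
      by (intro subfield_type_algebraD[OF subfield]) auto
  qed
  ultimately show thesis using L that by blast
qed

theorem K_magnified_origin:
  fixes a b v :: "'k::field"
  defines "E \<equiv> short_curve a b (v\<^sup>2)"
  assumes two: "(2::'k) \<noteq> 0" and elliptic: "elliptic_curve E" and "v \<noteq> 0"
    and magnified: "magnified_by_doubling E (Affine 0 v)"
  shows "K_magnified E (Affine 0 v)"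
proof -
  obtain L m where L: "finite_field_extension (range to_ac) L"
      "extension_degree (range to_ac) L < 4"
    and m: "m \<in> L" "eval_poly to_ac (halving_quartic a b v) m = 0"
    using magnified unfolding E_def by (rule halving_quartic_root_if_magnified_by_doubling)
  have degree: "degree (halving_quartic a b v) = 4"
    by (simp add: halving_quartic_def)
  obtain q r where qr: "halving_quartic a b v = q * r" "degree q > 0" "degree r > 0"
    using reducible_if_root_in_small_extension[OF L(1) m] L(2) degree by metis
  then consider (root) k where "poly (halving_quartic a b v) k = 0"
    | (quadratics) "degree q = 2" "degree r = 2"
    using reducible_quartic_cases[of q r] degree by auto
  thus ?thesis
  proof cases
    case root
    then obtain R where "on_curve E R" "point_add E R R = Affine 0 v"
      using half_if_halving_quartic_root[OF two] elliptic unfolding E_def by metis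
    thus ?thesis
      using K_magnified_double[OF two] elliptic unfolding E_def by (metis point.distinct(1))
  next
    case quadratics
    then obtain \<rho> where "\<rho> \<noteq> 0" "poly (cubic a b (v\<^sup>2)) (- \<rho>\<^sup>2) = 0"
      using resolvent_root_if_halving_quartic_factorization[OF two \<open>v \<noteq> 0\<close>] qr(1) by metis
    thus ?thesis
      using K_magnified_if_resolvent_root[OF two] elliptic unfolding E_def by blast
  qed
qed

lemma exists_short_coordinates:
  fixes E :: "'k::field curve"
  assumes two: "(2::'k) \<noteq> 0" and on_curve: "on_curve E (Affine x y)"
  obtains r s t a b v where "change_curve r s t E = short_curve a b (v\<^sup>2)"
    and "change_point r s t (Affine x y) = Affine 0 v"
proof -
  obtain a1 a2 a3 a4 a6 where E: "E = Weierstrass a1 a2 a3 a4 a6" by (cases E)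
  define s t where "s = - (a1 / 2)" and "t = - ((a3 + x * a1) / 2)"
  have "a1 + 2 * s = 0" "a3 + x * a1 + 2 * t = 0"
    using two by (simp_all add: s_def t_def)
  then obtain a b c where curve: "change_curve x s t E = short_curve a b c"
    by (simp add: E)
  have point: "change_point x s t (Affine x y) = Affine 0 (y - t)"
    by simp
  have "on_curve (short_curve a b c) (Affine 0 (y - t))"
    using on_curve_change[OF on_curve, of x s t] unfolding curve point .
  hence "c = (y - t)\<^sup>2"
    by simp
  thus thesis using that curve point by blast
qed

lemma two_neq_0_if_CHAR_neq_2:
  assumes "CHAR('a::field) \<noteq> 2"
  shows "(2::'a) \<noteq> 0"
proof
  assume "(2::'a) = 0"
  hence "CHAR('a) dvd 2"
    by (metis of_nat_eq_0_iff_char_dvd of_nat_numeral)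
  hence "CHAR('a) = 1 \<or> CHAR('a) = 2"
    using two_is_prime_nat prime_nat_iff by blast
  thus False using assms CHAR_not_1 by (simp add: CHAR_not_1')
qed

lemma torsion_point_if_double_eq_Infinity:
  assumes "point_add E P P = Infinity"
  shows "torsion_point E P"
proof -
  have "point_mult E 2 P = Infinity"
    using assms by (cases P) (simp_all add: point_mult_def eval_nat_numeral)
  thus ?thesis
    unfolding torsion_point_def by (intro exI[of _ 2]) simp
qed

theorem K_magnified_if_double_neq_Infinity:
  fixes E :: "'k::field curve"
  assumes two: "(2::'k) \<noteq> 0" and elliptic: "elliptic_curve E" and on_curve: "on_curve E P"
    and double: "point_add E P P \<noteq> Infinity" and magnified: "magnified_by_doubling E P"
  shows "K_magnified E P"
proof -
  obtain x y where P: "P = Affine x y"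
    using double by (cases P) auto
  obtain r s t a b v where curve: "change_curve r s t E = short_curve a b (v\<^sup>2)"
    and point: "change_point r s t P = Affine 0 v"
    using exists_short_coordinates[OF two] on_curve unfolding P by metis
  note change = curve[symmetric] point[symmetric]
  have "point_add (short_curve a b (v\<^sup>2)) (Affine 0 v) (Affine 0 v) \<noteq> Infinity"
    unfolding change point_double_change using double by (cases "point_add E P P") auto
  hence "v \<noteq> 0"
    by auto
  moreover have "elliptic_curve (short_curve a b (v\<^sup>2))"
    unfolding change elliptic_curve_change_curve by (rule elliptic)
  moreover have "magnified_by_doubling (short_curve a b (v\<^sup>2)) (Affine 0 v)"
    unfolding change using magnified by (rule magnified_by_doubling_change)
  ultimately have "K_magnified (short_curve a b (v\<^sup>2)) (Affine 0 v)"
    using K_magnified_origin[OF two] by blast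
  thus ?thesis
    unfolding change K_magnified_change_iff .
qed

theorem theorem1p2:
  fixes E :: "'k::field curve" and P :: "'k point"
  assumes "CHAR('k) \<noteq> 2"
    and "elliptic_curve E"
    and "on_curve E P"
    and "\<not> torsion_point E P"
    and "magnified_by_doubling E P"
  shows "K_magnified E P"
proof (rule K_magnified_if_double_neq_Infinity)
  show "(2::'k) \<noteq> 0"
    using assms(1) by (rule two_neq_0_if_CHAR_neq_2)
  show "point_add E P P \<noteq> Infinity"
    using assms(4) torsion_point_if_double_eq_Infinity by blast
qed (use assms in blast)+

end
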